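(* Let $Z=(Z_1,\dots,Z_d)$ be a Lévy martingale in $\mathbb{R}^d$ with independent coordinates, and let $F:[0,+\infty)\to\mathbb{R}$ and $G=(G_1,\dots,G_d):[0,+\infty)\to\mathbb{R}^d$ be deterministic functions. Assume that at least one of the following holds: (1) for each $i$, $\triangle Z_i(t)\ge0$ a.s. for $t>0$ and $Z_i$ is of infinite variation; (2) for each $i$, $\triangle Z_i(t)\ge0$ a.s. for $t>0$, and $G(0)=0$. Assume moreover that for all $i=1,\dots,d$ the Laplace exponent $J_i$ of $Z_i$ varies regularly at zero, and $G_i$ is nonnegative and continuous on $[0,+\infty)$. Suppose that the equation $dR(t)=F(R(t-))\,dt+\sum_{i=1}^dG_i(R(t-))\,dZ_i(t)$, $R(0)=r_0\ge0$, generates an affine model, so that $J_{Z^{G(x)}}(\beta)=x\sum_{k=1}^g\eta_k\beta^{\alpha_k}$, $\beta,x\ge0$, with some $1\le g\le d$, $\eta_k>0$ and $2\ge\alpha_1>\alpha_2>\dots>\alpha_g>1$. Let $\mu$ be the measure on $(0,+\infty)$ associated with the equation (see context) and let $J_\mu(\beta)=\int_0^{+\infty}(e^{-\beta v}-1+\beta v)\,\mu(dv)$, $\beta\ge 0$. Put $l=2$ if $\alpha_1=2$ and $l=1$ otherwise. Then $$J_\mu(\beta)=\sum_{k=l}^{g}\eta_k\beta^{\alpha_k},\qquad \beta\ge 0,$$ with $\eta_k>0$ and $2>\alpha_l>\dots>\alpha_g>1$ (for $l=2$, $g=1$ this means $J_\mu\equiv0$, i.e. $\mu$ vanishes). Equivalently,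 $\mu$ is a weighted sum of $g+1-l$ stable measures with indices $\alpha_l,\dots,\alpha_g\in(1,2)$: $$\mu(dv)=\frac{d_l}{v^{1+\alpha_l}}\mathbf{1}_{\{v>0\}}dv+\dots+\frac{d_g}{v^{1+\alpha_g}}\mathbf{1}_{\{v>0\}}dv,\qquad d_i=\frac{\eta_i}{c_{\alpha_i}},\quad i=l,\dots,g,$$ where $c_\alpha=\frac{\Gamma(2-\alpha)}{\alpha(\alpha-1)}$ for $\alpha\in(1,2)$.
   Context: Laplace exponents: for a real Lévy martingale $X$ the Laplace exponent $J_X$ is defined by $\mathbb{E}[e^{-\lambda X(t)}]=e^{tJ_X(\lambda)}$. For $Z_i$ with nonnegative jumps, $J_i(\beta)=\frac12 q_{ii}\beta^2+\int_0^{+\infty}(e^{-\beta v}-1+\beta v)\,\nu_i(dv)$, $\beta\ge0$, where $q_{ii}\ge0$ is the variance of the Wiener part and $\nu_i$ the Lévy measure of $Z_i$. $J_i$ varies regularly at zero if for every $\beta>0$ the limit $\lim_{x\to0^+}J_i(\beta x)/J_i(x)$ exists and equals $\psi_i(\beta)$ for some function $\psi_i$ (necessarily a power function). $\triangle Z_i(t)=Z_i(t)-Z_i(t-)$. For $x\ge0$, $Z^{G(x)}(t):=\langle G(x),Z(t)\rangle$. Generating an affine model: the equation is said to generate an affine model if it has a nonnegative solution $R$ for any initial value $R(0)\ge0$ and there exist smooth deterministic functions $A,B:[0,+\infty)\to\mathbb{R}$ such that, with $P(t,T):=e^{-A(T-t)-B(T-t)R(t)}$, $0\le t\le T$, $P(T,T)=1$,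 the process $e^{-\int_0^tR(s)\,ds}P(t,T)$, $t\in[0,T]$, is a local martingale for each $T\ge0$. The measure $\mu$: let $Q$ be the covariance matrix of the Wiener part of $Z$, $\nu$ the Lévy measure of $Z$, and $\nu_{G(x)}(A):=\nu\{y\in\mathbb{R}^d:\langle G(x),y\rangle\in A\}$. If the equation generates an affine model then there are a constant $c\ge0$ and a measure $\mu$ on $(0,+\infty)$ with $\int_{(0,+\infty)}(v\wedge v^2)\mu(dv)<+\infty$ such that for all $x\ge0$: $\frac12\langle QG(x),G(x)\rangle=cx$ and $\nu_{G(x)}|_{(0,+\infty)}=\nu_{G(0)}|_{(0,+\infty)}+x\mu$. Equivalently, $J_{Z^{G(x)}}(\beta)=c\beta^2x+\int_0^{+\infty}(e^{-\beta v}-1+\beta v)\nu_{G(0)}(dv)+xJ_\mu(\beta)$ for $\beta,x\ge0$. This is the measure $\mu$ of the claim. *)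

theory Defs
  imports "HOL-Probability.Probability"
begin

text \<open>
  Time is \<^typ>\<open>real\<close>, and only times \<open>t \<ge> 0\<close> matter: processes have type \<open>real \<Rightarrow> 'w \<Rightarrow> _\<close>, and
  their values at negative times are never used. No usual conditions are imposed on the filtration,
  so those filtrations that satisfy them are included.
\<close>

definition cadlag :: "(real \<Rightarrow> 'b::topological_space) \<Rightarrow> bool" where
  "cadlag f \<longleftrightarrow>
     (\<forall>t\<ge>0. (f \<longlongrightarrow> f t) (at_right t)) \<and> (\<forall>t>0. \<exists>l. (f \<longlongrightarrow> l) (at_left t))"

definition left_limit :: "(real \<Rightarrow> 'b::t2_space) \<Rightarrow> real \<Rightarrow> 'b" where
  "left_limit f t = Lim (at_left t) f"

definition infinite_variation :: "(real \<Rightarrow> real) \<Rightarrow> real \<Rightarrow> bool" where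
  "infinite_variation f t \<longleftrightarrow>
     (\<forall>C. \<exists>(n::nat) p. p ` {..n} \<subseteq> {0..t} \<and> mono_on {..n} p \<and>
        (\<Sum>k<n. \<bar>f (p (Suc k)) - f (p k)\<bar>) > C)"

definition filtered_prob_space :: "'w measure \<Rightarrow> (real \<Rightarrow> 'w measure) \<Rightarrow> bool" where
  "filtered_prob_space M Filt \<longleftrightarrow>
     prob_space M \<and> filtration (space M) Filt \<and> (\<forall>t. subalgebra M (Filt t))"

definition adapted :: "(real \<Rightarrow> 'w measure) \<Rightarrow> (real \<Rightarrow> 'w \<Rightarrow> 'b::topological_space) \<Rightarrow> bool" where
  "adapted Filt X \<longleftrightarrow> (\<forall>t\<ge>0. X t \<in> borel_measurable (Filt t))"

definition martingale_on ::
  "'w measure \<Rightarrow> (real \<Rightarrow> 'w measure) \<Rightarrow> real set \<Rightarrow> (real \<Rightarrow> 'w \<Rightarrow> real) \<Rightarrow> bool" where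
  "martingale_on M Filt S X \<longleftrightarrow>
     (\<forall>t\<in>S. X t \<in> borel_measurable (Filt t) \<and> integrable M (X t)) \<and>
     (\<forall>s\<in>S. \<forall>t\<in>S. s \<le> t \<longrightarrow> (AE \<omega> in M. real_cond_exp M (Filt s) (X t) \<omega> = X s \<omega>))"

text \<open>
  Local martingale on the finite horizon \<open>[0,T]\<close>: almost surely the localizing times eventually
  reach \<open>T\<close>. No \<open>X 0\<close> is subtracted, since the definition is only applied to processes with
  deterministic initial value.
\<close>

definition local_martingale_upto ::
  "'w measure \<Rightarrow> (real \<Rightarrow> 'w measure) \<Rightarrow> real \<Rightarrow> (real \<Rightarrow> 'w \<Rightarrow> real) \<Rightarrow> bool" where
  "local_martingale_upto M Filt T X \<longleftrightarrow>
     (\<exists>\<tau> :: nat \<Rightarrow> 'w \<Rightarrow> real.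
        (\<forall>n. stopping_time Filt (\<tau> n)) \<and>
        (\<forall>n. \<forall>\<omega>\<in>space M. 0 \<le> \<tau> n \<omega> \<and> \<tau> n \<omega> \<le> \<tau> (Suc n) \<omega>) \<and>
        (AE \<omega> in M. \<exists>n. T \<le> \<tau> n \<omega>) \<and>
        (\<forall>n. martingale_on M Filt {0..T} (\<lambda>t \<omega>. X (min t (\<tau> n \<omega>)) \<omega>)))"

definition levy_process ::
  "'w measure \<Rightarrow> (real \<Rightarrow> 'w measure) \<Rightarrow> (real \<Rightarrow> 'w \<Rightarrow> 'b::euclidean_space) \<Rightarrow> bool" where
  "levy_process M Filt Z \<longleftrightarrow>
     adapted Filt Z \<and>
     (AE \<omega> in M. Z 0 \<omega> = 0) \<and>
     (AE \<omega> in M. cadlag (\<lambda>t. Z t \<omega>)) \<and>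
     (\<forall>s\<ge>0. \<forall>t\<ge>s.
        prob_space.indep_set M (sets (Filt s))
          {(\<lambda>\<omega>. Z t \<omega> - Z s \<omega>) -` B \<inter> space M | B. B \<in> sets borel}) \<and>
     (\<forall>s\<ge>0. \<forall>t\<ge>s. distr M borel (\<lambda>\<omega>. Z t \<omega> - Z s \<omega>) = distr M borel (Z (t - s)))"

definition levy_martingale ::
  "'w measure \<Rightarrow> (real \<Rightarrow> 'w measure) \<Rightarrow> (real \<Rightarrow> 'w \<Rightarrow> real ^ 'd) \<Rightarrow> bool" where
  "levy_martingale M Filt Z \<longleftrightarrow>
     levy_process M Filt Z \<and> (\<forall>i. martingale_on M Filt {0..} (\<lambda>t \<omega>. Z t \<omega> $ i))"

definition independent_coordinates :: "'w measure \<Rightarrow> (real \<Rightarrow> 'w \<Rightarrow> real ^ 'd) \<Rightarrow> bool" where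
  "independent_coordinates M Z \<longleftrightarrow>
     prob_space.indep_vars M (\<lambda>_. Pi\<^sub>M {0..} (\<lambda>_. borel)) (\<lambda>i \<omega>. \<lambda>t\<in>{0..}. Z t \<omega> $ i) (UNIV :: 'd set)"

text \<open>
  \<open>Q\<close> is the covariance matrix of the Wiener part and \<open>\<nu>\<close> the Levy measure of the Levy
  martingale \<open>Z\<close>, through the Levy-Khintchine formula. For a martingale all jumps can be compensated
  and there is no drift term.
\<close>

definition wiener_cov_levy_measure ::
  "'w measure \<Rightarrow> (real \<Rightarrow> 'w \<Rightarrow> real ^ 'd) \<Rightarrow> real ^ 'd ^ 'd \<Rightarrow> (real ^ 'd) measure \<Rightarrow> bool" where
  "wiener_cov_levy_measure M Z Q \<nu> \<longleftrightarrow>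
     transpose Q = Q \<and> (\<forall>u. 0 \<le> (Q *v u) \<bullet> u) \<and>
     sets \<nu> = sets borel \<and> emeasure \<nu> {0} = 0 \<and>
     (\<integral>\<^sup>+ y. ennreal (min (norm y) ((norm y)\<^sup>2)) \<partial>\<nu>) < \<infinity> \<and>
     (\<forall>t\<ge>0. \<forall>u.
        (CLINT \<omega>|M. iexp (u \<bullet> Z t \<omega>)) =
          exp (of_real t *
            (- of_real ((Q *v u) \<bullet> u / 2) +
             (CLINT y|\<nu>. iexp (u \<bullet> y) - 1 - \<i> * of_real (u \<bullet> y)))))"

definition has_laplace_exponent ::
  "'w measure \<Rightarrow> (real \<Rightarrow> 'w \<Rightarrow> real) \<Rightarrow> (real \<Rightarrow> real) \<Rightarrow> bool" where
  "has_laplace_exponent M X J \<longleftrightarrow>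
     (\<forall>\<beta>\<ge>0. \<forall>t\<ge>0.
        integrable M (\<lambda>\<omega>. exp (- \<beta> * X t \<omega>)) \<and>
        (LINT \<omega>|M. exp (- \<beta> * X t \<omega>)) = exp (t * J \<beta>))"

text \<open>
  The quotient in the next definition requires \<open>J \<noteq> 0\<close> near zero; as \<open>x / 0 = 0\<close> in HOL, this has to
  be said explicitly.
\<close>

definition varies_regularly_at_zero :: "(real \<Rightarrow> real) \<Rightarrow> bool" where
  "varies_regularly_at_zero J \<longleftrightarrow>
     (\<forall>\<^sub>F x in at_right 0. J x \<noteq> 0) \<and>
     (\<exists>\<psi> :: real \<Rightarrow> real. \<forall>\<beta>>0. ((\<lambda>x. J (\<beta> * x) / J x) \<longlongrightarrow> \<psi> \<beta>) (at_right 0))"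

text \<open>
  Uniform convergence on compacts in probability. The covering events \<open>A n\<close> make this convergence in
  outer probability, so that possible non-measurability of the exceptional sets is harmless.
\<close>

definition ucp_tendsto ::
  "'w measure \<Rightarrow> (nat \<Rightarrow> real \<Rightarrow> 'w \<Rightarrow> real) \<Rightarrow> (real \<Rightarrow> 'w \<Rightarrow> real) \<Rightarrow> bool" where
  "ucp_tendsto M X Y \<longleftrightarrow>
     (\<forall>t>0. \<forall>\<epsilon>>0. \<exists>A :: nat \<Rightarrow> 'w set.
        (\<forall>n. A n \<in> sets M \<and>
             {\<omega> \<in> space M. \<exists>s\<in>{0<..t}. \<bar>X n s \<omega> - Y s \<omega>\<bar> > \<epsilon>} \<subseteq> A n) \<and>
        (\<lambda>n. measure M (A n)) \<longlonglongrightarrow> 0)"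

text \<open>
  The stochastic integral over \<open>(0,t]\<close> of an adapted left-continuous process with right limits:
  continuous extension, with respect to ucp convergence, of the elementary integral of simple
  predictable processes \<open>\<Sum>k<N. H k * 1\<^bsub>(T k, T (k+1)]\<^esub>\<close>, where the \<open>T k\<close> are stopping times and
  \<open>H k\<close> is measurable with respect to the \<open>\<sigma>\<close>-algebra of the events prior to \<open>T k\<close>.
\<close>

definition simple_predictable ::
  "'w measure \<Rightarrow> (real \<Rightarrow> 'w measure) \<Rightarrow> nat \<Rightarrow> (nat \<Rightarrow> 'w \<Rightarrow> real) \<Rightarrow> (nat \<Rightarrow> 'w \<Rightarrow> real) \<Rightarrow> bool" where
  "simple_predictable M Filt N T H \<longleftrightarrow>
     (\<forall>k\<le>N. stopping_time Filt (T k)) \<and>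
     (\<forall>\<omega>\<in>space M. T 0 \<omega> = 0 \<and> (\<forall>k<N. T k \<omega> \<le> T (Suc k) \<omega>)) \<and>
     (\<forall>k<N. H k \<in> borel_measurable (filtration.pre_sigma (space M) Filt (T k)))"

definition simple_process ::
  "nat \<Rightarrow> (nat \<Rightarrow> 'w \<Rightarrow> real) \<Rightarrow> (nat \<Rightarrow> 'w \<Rightarrow> real) \<Rightarrow> real \<Rightarrow> 'w \<Rightarrow> real" where
  "simple_process N T H s \<omega> = (\<Sum>k<N. H k \<omega> * indicator {T k \<omega><..T (Suc k) \<omega>} s)"

definition simple_integral_process ::
  "nat \<Rightarrow> (nat \<Rightarrow> 'w \<Rightarrow> real) \<Rightarrow> (nat \<Rightarrow> 'w \<Rightarrow> real) \<Rightarrow> (real \<Rightarrow> 'w \<Rightarrow> real) \<Rightarrow> real \<Rightarrow> 'w \<Rightarrow> real" where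
  "simple_integral_process N T H X t \<omega> =
     (\<Sum>k<N. H k \<omega> * (X (min (T (Suc k) \<omega>) t) \<omega> - X (min (T k \<omega>) t) \<omega>))"

definition has_stochastic_integral ::
  "'w measure \<Rightarrow> (real \<Rightarrow> 'w measure) \<Rightarrow> (real \<Rightarrow> 'w \<Rightarrow> real) \<Rightarrow> (real \<Rightarrow> 'w \<Rightarrow> real) \<Rightarrow>
   (real \<Rightarrow> 'w \<Rightarrow> real) \<Rightarrow> bool" where
  "has_stochastic_integral M Filt Y X I \<longleftrightarrow>
     adapted Filt I \<and> (AE \<omega> in M. cadlag (\<lambda>t. I t \<omega>)) \<and>
     (\<exists>N T H.
        (\<forall>n. simple_predictable M Filt (N n) (T n) (H n)) \<and>
        ucp_tendsto M (\<lambda>n. simple_process (N n) (T n) (H n)) Y \<and>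
        ucp_tendsto M (\<lambda>n. simple_integral_process (N n) (T n) (H n) X) I)"

text \<open>
  Nonnegative solution of \<open>dR(t) = Fd(R(t-)) dt + \<Sum>i. G\<^sub>i(R(t-)) dZ\<^sub>i(t)\<close>, \<open>R(0) = r0\<close>.
\<close>

definition nonneg_solution ::
  "'w measure \<Rightarrow> (real \<Rightarrow> 'w measure) \<Rightarrow> (real \<Rightarrow> 'w \<Rightarrow> real ^ 'd) \<Rightarrow> (real \<Rightarrow> real) \<Rightarrow>
   (real \<Rightarrow> real ^ 'd) \<Rightarrow> real \<Rightarrow> (real \<Rightarrow> 'w \<Rightarrow> real) \<Rightarrow> bool" where
  "nonneg_solution M Filt Z Fd G r0 R \<longleftrightarrow>
     adapted Filt R \<and>
     (AE \<omega> in M. cadlag (\<lambda>t. R t \<omega>)) \<and>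
     (AE \<omega> in M. R 0 \<omega> = r0) \<and>
     (AE \<omega> in M. \<forall>t\<ge>0. 0 \<le> R t \<omega>) \<and>
     (AE \<omega> in M. \<forall>t\<ge>0. (\<lambda>s. Fd (left_limit (\<lambda>u. R u \<omega>) s)) absolutely_integrable_on {0..t}) \<and>
     (\<exists>I :: 'd \<Rightarrow> real \<Rightarrow> 'w \<Rightarrow> real.
        (\<forall>i. has_stochastic_integral M Filt
               (\<lambda>s \<omega>. G (left_limit (\<lambda>u. R u \<omega>) s) $ i) (\<lambda>t \<omega>. Z t \<omega> $ i) (I i)) \<and>
        (AE \<omega> in M. \<forall>t\<ge>0.
           R t \<omega> = r0 + integral {0..t} (\<lambda>s. Fd (left_limit (\<lambda>u. R u \<omega>) s)) + (\<Sum>i\<in>UNIV. I i t \<omega>)))"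

text \<open>
  Smoothness of the deterministic functions is read as \<open>C\<^sup>1\<close> on \<open>[0,\<infinity>)\<close>. It cannot mean
  \<open>C\<^sup>\<infinity>\<close> up to \<open>0\<close>: for \<open>\<alpha>\<close>-stable noise with \<open>1 < \<alpha> < 2\<close> the function \<open>B\<close> solves a Riccati-type
  equation containing \<open>B powr \<alpha>\<close> with \<open>B 0 = 0\<close>, and its third derivative blows up at \<open>0\<close>.
\<close>

definition C1_on_nonneg :: "(real \<Rightarrow> real) \<Rightarrow> bool" where
  "C1_on_nonneg f \<longleftrightarrow>
     (\<exists>f'. (\<forall>t\<ge>0. (f has_real_derivative f' t) (at t within {0..})) \<and> continuous_on {0..} f')"

definition generates_affine_model ::
  "'w measure \<Rightarrow> (real \<Rightarrow> 'w measure) \<Rightarrow> (real \<Rightarrow> 'w \<Rightarrow> real ^ 'd) \<Rightarrow> (real \<Rightarrow> real) \<Rightarrow>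
   (real \<Rightarrow> real ^ 'd) \<Rightarrow> bool" where
  "generates_affine_model M Filt Z Fd G \<longleftrightarrow>
     (\<exists>A B. C1_on_nonneg A \<and> C1_on_nonneg B \<and>
        (\<forall>r0\<ge>0. \<exists>R. nonneg_solution M Filt Z Fd G r0 R \<and>
           (\<forall>T\<ge>0.
              (AE \<omega> in M. exp (- A 0 - B 0 * R T \<omega>) = 1) \<and>
              local_martingale_upto M Filt T
                (\<lambda>t \<omega>. exp (- integral {0..t} (\<lambda>s. R s \<omega>)) *
                        exp (- A (T - t) - B (T - t) * R t \<omega>)))))"

definition image_levy_measure :: "(real ^ 'd) measure \<Rightarrow> real ^ 'd \<Rightarrow> real measure" where
  "image_levy_measure \<nu> g = distr \<nu> borel (\<lambda>y. g \<bullet> y)"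

text \<open>Measures on \<open>(0,\<infinity>)\<close> are measures on the Borel subsets of \<^term>\<open>{0<..} :: real set\<close>.\<close>

definition affine_jump_measure ::
  "real ^ 'd ^ 'd \<Rightarrow> (real ^ 'd) measure \<Rightarrow> (real \<Rightarrow> real ^ 'd) \<Rightarrow> real measure \<Rightarrow> bool" where
  "affine_jump_measure Q \<nu> G \<mu> \<longleftrightarrow>
     sets \<mu> = sets (restrict_space borel {0<..}) \<and>
     (\<integral>\<^sup>+ v. ennreal (min v (v\<^sup>2)) \<partial>\<mu>) < \<infinity> \<and>
     (\<exists>c\<ge>0. \<forall>x\<ge>0. (Q *v G x) \<bullet> G x / 2 = c * x) \<and>
     (\<forall>x\<ge>0. \<forall>A\<in>sets borel. A \<subseteq> {0<..} \<longrightarrow>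
        emeasure (image_levy_measure \<nu> (G x)) A =
          emeasure (image_levy_measure \<nu> (G 0)) A + ennreal x * emeasure \<mu> A)"

definition J_measure :: "real measure \<Rightarrow> real \<Rightarrow> real" where
  "J_measure \<mu> \<beta> = (LINT v|\<mu>. exp (- \<beta> * v) - 1 + \<beta> * v)"

definition stable_const :: "real \<Rightarrow> real" where
  "stable_const \<alpha> = Gamma (2 - \<alpha>) / (\<alpha> * (\<alpha> - 1))"

definition stable_measure :: "real \<Rightarrow> real \<Rightarrow> real measure" where
  "stable_measure d \<alpha> = density (restrict_space lborel {0<..}) (\<lambda>v. ennreal (d / v powr (1 + \<alpha>)))"

end

theory Submission
  imports Defs "HOL-Complex_Analysis.Complex_Analysis"
begin

text \<open>
  The Laplace exponent of \<open>\<langle>G(x), Z\<rangle>\<close> is holomorphic in the right half-plane and continuous up to the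
  imaginary axis, as is the compensated exponential integral of any Levy measure on \<open>(0,\<infinity>)\<close> that
  represents it for real arguments. Comparing both on the imaginary axis and using the uniqueness of
  the Levy-Khintchine triplet identifies the Levy measure of \<open>\<langle>G(x), Z\<rangle>\<close>: for \<open>x = 0\<close> the exponent
  vanishes and so does the Levy measure, for \<open>x = 1\<close> it is the mixture of stable measures with the
  exponents below \<open>2\<close>. The affine decomposition at \<open>x = 1\<close> then says that \<open>\<mu>\<close> is this mixture.

  The triplet is recovered from the exponent \<open>\<Psi>\<close> by letting \<open>\<Psi>(u) / u\<^sup>2\<close> tend to the Gaussian
  coefficient and by reading the second differences of \<open>\<Psi>\<close> as characteristic functions of finite
  measures.
\<close>

subsection \<open>Holomorphic parameter integrals\<close>

text \<open>Differentiation under the integral sign. Only \<open>f\<close> itself needs a locally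
  uniform integrable bound: Cauchy's inequality converts it into a bound on the derivative, hence on
  the difference quotients, and dominated convergence does the rest.\<close>

lemma holomorphic_on_integral:
  fixes f :: "complex \<Rightarrow> 'a \<Rightarrow> complex"
  assumes S: "open S"
    and meas: "\<And>z. z \<in> S \<Longrightarrow> f z \<in> borel_measurable N"
    and hol: "\<And>x. (\<lambda>z. f z x) holomorphic_on S"
    and dom: "\<And>z. z \<in> S \<Longrightarrow> \<exists>r>0. \<exists>g::'a \<Rightarrow> real. cball z r \<subseteq> S \<and> integrable N g \<and>
                (AE x in N. \<forall>w\<in>cball z r. norm (f w x) \<le> g x)"
  shows "(\<lambda>z. LINT x|N. f z x) holomorphic_on S"
proof -
  have "(\<lambda>z. LINT x|N. f z x) field_differentiable (at z)" if zS: "z \<in> S" for z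
  proof -
    obtain r g where r: "r > 0" "cball z r \<subseteq> S" and g: "integrable N g"
      and bd: "AE x in N. \<forall>w\<in>cball z r. norm (f w x) \<le> g x"
      using dom[OF zS] by blast
    let ?D = "\<lambda>x. deriv (\<lambda>z. f z x) z"
    have int: "integrable N (f w)" if "w \<in> cball z r" for w
    proof (rule Bochner_Integration.integrable_bound[OF g])
      show "f w \<in> borel_measurable N" using meas that r by auto
      show "AE x in N. norm (f w x) \<le> norm (g x)"
        using bd by eventually_elim (use that in force)
    qed
    have der: "((\<lambda>z. f z x) has_field_derivative deriv (\<lambda>z. f z x) w) (at w)" if "w \<in> S" for w x
      using holomorphic_derivI[OF hol S that] .
    have quot: "((\<lambda>w. (f w x - f z x) / (w - z)) \<longlongrightarrow> ?D x) (at z)" for x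
      using der[OF \<open>z \<in> S\<close>] by (simp add: has_field_derivative_iff)
    have lip: "norm ((f w x - f z x) / (w - z)) \<le> g x / (r/2)"
      if x: "\<forall>w\<in>cball z r. norm (f w x) \<le> g x" and w: "w \<in> ball z (r/2)" "w \<noteq> z" for x w
    proof -
      \<comment> \<open>Two radii \<open>r/2\<close> add up to \<open>r\<close>: the Cauchy disc
        around any \<open>y\<close> in \<open>ball z (r/2)\<close> stays inside
        \<open>cball z r\<close>, where \<open>g x\<close> dominates.\<close>
      have 1: "norm (deriv (\<lambda>z. f z x) y) \<le> g x / (r/2)" if y: "y \<in> ball z (r/2)" for y
      proof -
        have sub: "cball y (r/2) \<subseteq> cball z r"
          using y by (auto simp: dist_commute) (smt (verit) dist_commute dist_triangle_half_r dist_triangle field_sum_of_halves)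
        have h: "(\<lambda>z. f z x) holomorphic_on cball y (r/2)"
          using hol sub r(2) by (meson holomorphic_on_subset order_trans)
        have "norm ((deriv ^^ 1) (\<lambda>z. f z x) y) \<le> fact 1 * g x / (r/2)^1"
        proof (rule Cauchy_inequality)
          show "(\<lambda>z. f z x) holomorphic_on ball y (r/2)"
            using h by (meson ball_subset_cball holomorphic_on_subset)
          show "continuous_on (cball y (r/2)) (\<lambda>z. f z x)"
            using h holomorphic_on_imp_continuous_on by blast
          show "norm (f u x) \<le> g x" if "cmod (y - u) = r/2" for u
            using x sub that by (metis dist_norm mem_cball order_refl subsetD)
        qed (use r in auto)
        then show ?thesis by simp
      qed
      have "norm (f w x - f z x) \<le> g x / (r/2) * norm (w - z)"
      proof (rule field_differentiable_bound[OF convex_ball[of z "r/2"]])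
        fix y assume y: "y \<in> ball z (r/2)"
        then have "y \<in> S" using r by (auto simp: subset_iff)
        then show "((\<lambda>z. f z x) has_field_derivative deriv (\<lambda>z. f z x) y) (at y within ball z (r/2))"
          using der has_field_derivative_at_within by blast
      qed (use 1 w r in auto)
      then show ?thesis using w r by (simp add: norm_divide divide_simps)
    qed
    \<comment> \<open>Dominated convergence concerns sequences, so the limit at \<open>z\<close> is
      tested along arbitrary sequences; dropping the first \<open>N0\<close> terms puts them inside
      the ball where \<open>lip\<close> applies.\<close>
    have "((\<lambda>w. LINT x|N. (f w x - f z x) / (w - z)) \<longlongrightarrow> (LINT x|N. ?D x)) (at z)"
      unfolding tendsto_at_iff_sequentially
    proof (intro allI impI, unfold comp_def)
      fix X :: "nat \<Rightarrow> complex" assume X: "\<forall>i. X i \<in> UNIV - {z}" "X \<longlonglongrightarrow> z"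
      then have "\<forall>\<^sub>F i in sequentially. X i \<in> ball z (r/2)"
        using r by (intro topological_tendstoD[OF X(2)]) auto
      then obtain N0 where N0: "\<And>i. i \<ge> N0 \<Longrightarrow> X i \<in> ball z (r/2)"
        by (auto simp: eventually_sequentially)
      have XS: "X (i + N0) \<in> S" for i
        using N0[of "i + N0"] r by (auto simp: subset_iff)
      have m: "(\<lambda>x. (f (X (i + N0)) x - f z x) / (X (i + N0) - z)) \<in> borel_measurable N" for i
        using meas[OF XS] meas[OF \<open>z \<in> S\<close>] by measurable
      have lim: "(\<lambda>i. (f (X (i + N0)) x - f z x) / (X (i + N0) - z)) \<longlonglongrightarrow> ?D x" for x
        using quot[of x, unfolded tendsto_at_iff_sequentially, rule_format, of X] X
        by (auto simp: comp_def intro: LIMSEQ_ignore_initial_segment)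
      show "(\<lambda>i. LINT x|N. (f (X i) x - f z x) / (X i - z)) \<longlonglongrightarrow> (LINT x|N. ?D x)"
      proof (rule LIMSEQ_offset[where k=N0], rule integral_dominated_convergence)
        show "?D \<in> borel_measurable N"
          by (rule borel_measurable_LIMSEQ_metric[OF m lim])
        show "integrable N (\<lambda>x. g x / (r/2))" using g by auto
        show "AE x in N. norm ((f (X (i + N0)) x - f z x) / (X (i + N0) - z)) \<le> g x / (r/2)" for i
          using bd by eventually_elim (rule lip, use N0[of "i+N0"] X in auto)
      qed (use m lim in auto)
    qed
    moreover have "\<forall>\<^sub>F w in at z. (LINT x|N. (f w x - f z x) / (w - z))
          = ((LINT x|N. f w x) - (LINT x|N. f z x)) / (w - z)"
    proof -
      have "\<forall>\<^sub>F w in at z. w \<in> ball z r"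
        using r by (intro eventually_at_in_open') auto
      then show ?thesis
        by eventually_elim (use int r in \<open>simp add: Bochner_Integration.integral_diff\<close>)
    qed
    ultimately have "((\<lambda>w. ((LINT x|N. f w x) - (LINT x|N. f z x)) / (w - z)) \<longlongrightarrow> (LINT x|N. ?D x)) (at z)"
      by (rule Lim_transform_eventually)
    then show ?thesis
      unfolding field_differentiable_def has_field_derivative_iff by blast
  qed
  then show ?thesis
    unfolding holomorphic_on_def using field_differentiable_at_within by blast
qed

text \<open>One entire function of \<open>z\<close> carries both exponents: real \<open>z\<close>
  gives the integrand of the Laplace exponent, imaginary \<open>z\<close> that of the
  Levy-Khintchine formula.\<close>

definition compensated_exp :: "complex \<Rightarrow> real \<Rightarrow> complex" where
  "compensated_exp z v = exp (- (z * of_real v)) - 1 + z * of_real v"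

lemma compensated_exp_measurable [measurable]: "compensated_exp z \<in> borel_measurable borel"
  unfolding compensated_exp_def by measurable

lemma compensated_exp_holomorphic: "(\<lambda>z. compensated_exp z v) holomorphic_on S"
  unfolding compensated_exp_def by (intro holomorphic_intros)

lemma compensated_exp_of_real:
  "compensated_exp (of_real \<beta>) v = of_real (exp (- \<beta> * v) - 1 + \<beta> * v)"
  unfolding compensated_exp_def by (simp flip: exp_of_real)

lemma compensated_exp_imaginary:
  "compensated_exp (- (\<i> * of_real u)) v = iexp (u * v) - 1 - \<i> * of_real (u * v)"
  unfolding compensated_exp_def by (simp add: mult_ac)

text \<open>On the right half-plane \<open>exp (- w)\<close> has a derivative of modulus at most 1.
  The mean value inequality, applied to it and then to \<open>exp (- w) - 1 + w\<close>, yields a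
  bound suited to large jumps and one suited to small jumps.\<close>

lemma
  assumes "0 \<le> Re z * v"
  shows norm_compensated_exp_le_linear: "norm (compensated_exp z v) \<le> 2 * norm z * \<bar>v\<bar>"
    and norm_compensated_exp_le_square: "norm (compensated_exp z v) \<le> (norm z)\<^sup>2 * v\<^sup>2"
proof -
  let ?H = "{w::complex. 0 \<le> Re w}"
  have cvx: "convex ?H"
    using convex_halfspace_Re_ge[of 0] by simp
  have 1: "norm (exp (- w) - 1) \<le> norm w" if "w \<in> ?H" for w :: complex
  proof -
    have "norm (exp (- w) - exp (- 0)) \<le> 1 * norm (w - 0)"
      by (rule field_differentiable_bound[OF cvx, where f' = "\<lambda>w. - exp (- w)"])
        (use that in \<open>auto intro!: derivative_eq_intros\<close>)
    then show ?thesis by simp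
  qed
  have 2: "norm (exp (- w) - 1 + w) \<le> norm w * norm w" if "w \<in> ?H" for w :: complex
  proof -
    \<comment> \<open>Cutting the half-plane with the disc of radius \<open>norm w\<close> keeps the
      domain convex and bounds the derivative by \<open>norm w\<close>.\<close>
    have cv: "convex (?H \<inter> cball 0 (norm w))"
      using cvx by (intro convex_Int) auto
    have "norm ((exp (- w) - 1 + w) - (exp (- 0) - 1 + 0)) \<le> norm w * norm (w - 0)"
    proof (rule field_differentiable_bound[OF cv, where f' = "\<lambda>w. 1 - exp (- w)"])
      show "norm (1 - exp (- y)) \<le> norm w" if "y \<in> ?H \<inter> cball 0 (norm w)" for y
        using 1[of y] that by (auto simp: norm_minus_commute)
    qed (use that in \<open>auto intro!: derivative_eq_intros\<close>)
    then show ?thesis by simp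
  qed
  let ?w = "z * of_real v"
  have w: "?w \<in> ?H" using assms by simp
  have nw: "norm ?w = norm z * \<bar>v\<bar>" by (simp add: norm_mult)
  show "norm (compensated_exp z v) \<le> 2 * norm z * \<bar>v\<bar>"
    using norm_triangle_ineq[of "exp (- ?w) - 1" ?w] 1[OF w]
    unfolding compensated_exp_def nw by linarith
  show "norm (compensated_exp z v) \<le> (norm z)\<^sup>2 * v\<^sup>2"
    using 2[OF w] unfolding compensated_exp_def nw
    by (simp add: power2_eq_square mult_ac)
qed

text \<open>The factor depends on \<open>z\<close> only through its norm, so a single multiple of
  \<open>min \<bar>v\<bar> (v\<^sup>2)\<close> dominates uniformly for bounded
  \<open>z\<close>.\<close>

lemma norm_compensated_exp_le:
  assumes "0 \<le> Re z * v"
  shows "norm (compensated_exp z v) \<le> (2 * norm z + (norm z)\<^sup>2) * min \<bar>v\<bar> (v\<^sup>2)"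
proof -
  note a = norm_compensated_exp_le_linear[OF assms] and b = norm_compensated_exp_le_square[OF assms]
  show ?thesis
  proof (cases "\<bar>v\<bar> \<le> v\<^sup>2")
    case True
    have "2 * norm z * \<bar>v\<bar> \<le> (2 * norm z + (norm z)\<^sup>2) * \<bar>v\<bar>" by (simp add: algebra_simps)
    then show ?thesis using a True by (simp add: min_def)
  next
    case False
    have "(norm z)\<^sup>2 * v\<^sup>2 \<le> (2 * norm z + (norm z)\<^sup>2) * v\<^sup>2" by (simp add: algebra_simps)
    then show ?thesis using b False by (simp add: min_def)
  qed
qed

lemma integrable_compensated_exp:
  assumes "sets \<rho> = sets borel" "integrable \<rho> (\<lambda>v. min \<bar>v\<bar> (v\<^sup>2))" "AE v in \<rho>. 0 \<le> Re z * v"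
  shows "integrable \<rho> (compensated_exp z)"
proof (rule Bochner_Integration.integrable_bound)
  show "integrable \<rho> (\<lambda>v. (2 * norm z + (norm z)\<^sup>2) * min \<bar>v\<bar> (v\<^sup>2))"
    using assms by auto
  show "compensated_exp z \<in> borel_measurable \<rho>"
    using compensated_exp_measurable by (simp add: measurable_cong_sets[OF assms(1) refl])
  show "AE v in \<rho>. norm (compensated_exp z v) \<le> norm ((2 * norm z + (norm z)\<^sup>2) * min \<bar>v\<bar> (v\<^sup>2))"
    using assms(3) by eventually_elim (simp add: norm_compensated_exp_le)
qed

lemma holomorphic_on_integral_compensated_exp:
  assumes sets: "sets \<rho> = sets borel" and int: "integrable \<rho> (\<lambda>v. min \<bar>v\<bar> (v\<^sup>2))"
    and pos: "AE v in \<rho>. 0 < v"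
  shows "(\<lambda>z. LINT v|\<rho>. compensated_exp z v) holomorphic_on {z. 0 < Re z}"
proof (rule holomorphic_on_integral)
  fix z :: complex assume z: "z \<in> {z. 0 < Re z}"
  have op: "open {z. 0 < Re z}" by (rule open_halfspace_Re_gt)
  then obtain r where r: "r > 0" "cball z r \<subseteq> {z. 0 < Re z}"
    using z open_contains_cball by blast
  \<comment> \<open>The factor of \<open>norm_compensated_exp_le\<close> at
    \<open>norm z + r\<close>, an upper bound for the modulus on \<open>cball z r\<close>.\<close>
  define C where "C = (2 * (norm z + r) + (norm z + r)\<^sup>2)"
  have "norm (compensated_exp w v) \<le> C * min \<bar>v\<bar> (v\<^sup>2)" if "w \<in> cball z r" "v > 0" for w v
  proof -
    have "norm w \<le> norm z + r"
      using that(1) norm_triangle_ineq2[of w z] by (auto simp: dist_norm norm_minus_commute)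
    then have "2 * norm w + (norm w)\<^sup>2 \<le> C"
      unfolding C_def by (intro add_mono power_mono) auto
    moreover have "0 \<le> Re w * v" using that r by (auto simp: subset_iff less_imp_le)
    ultimately show ?thesis
      using norm_compensated_exp_le[of w v] by (meson mult_right_mono order_trans min.boundedI abs_ge_zero zero_le_power2)
  qed
  then have "AE v in \<rho>. \<forall>w\<in>cball z r. norm (compensated_exp w v) \<le> C * min \<bar>v\<bar> (v\<^sup>2)"
    by (intro eventually_mono[OF pos]) blast
  then show "\<exists>r>0. \<exists>g::real \<Rightarrow> real. cball z r \<subseteq> {z. 0 < Re z} \<and> integrable \<rho> g \<and>
      (AE x in \<rho>. \<forall>w\<in>cball z r. norm (compensated_exp w x) \<le> g x)"
    using r integrable_mult_right[OF int, of C] by blast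
next
  show "compensated_exp z \<in> borel_measurable \<rho>" for z
    using compensated_exp_measurable by (simp add: measurable_cong_sets[OF sets refl])
qed (auto simp: open_halfspace_Re_gt compensated_exp_holomorphic)

subsection \<open>Uniqueness of the Levy-Khintchine triplet\<close>

text \<open>The value of \<open>char\<close> at 0 is the total mass, so equal characteristic
  functions force equal masses, and dividing by the mass reduces the claim to probability measures.
  Mass zero cannot be normalised and is treated apart.\<close>

lemma finite_Levy_uniqueness:
  fixes M1 M2 :: "real measure"
  assumes "finite_measure M1" "finite_measure M2"
    and [measurable_cong]: "sets M1 = sets borel" "sets M2 = sets borel"
    and char: "char M1 = char M2"
  shows "M1 = M2"
proof -
  have c0: "char N 0 = of_real (measure N (space N))" for N
    by (simp add: char_def scaleR_conv_of_real)
  define m where "m = measure M1 (space M1)"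
  have m2: "m = measure M2 (space M2)"
    using c0[of M1] c0[of M2] unfolding char m_def by simp
  have sp: "space M1 = UNIV" "space M2 = UNIV"
    using sets_eq_imp_space_eq[OF assms(3)] sets_eq_imp_space_eq[OF assms(4)] by auto
  have m1e: "emeasure M1 (space M1) = ennreal m" and m2e: "emeasure M2 (space M2) = ennreal m"
    using finite_measure.emeasure_eq_measure[OF assms(1)] finite_measure.emeasure_eq_measure[OF assms(2)]
    by (simp_all add: m_def[symmetric] m2[symmetric])
  show ?thesis
  proof (cases "m = 0")
    case True
    have "emeasure M1 A = 0" "emeasure M2 A = 0" for A
      using emeasure_space[of M1 A] emeasure_space[of M2 A] m1e m2e True by auto
    then show ?thesis by (intro measure_eqI) (simp_all add: assms)
  next
    case False
    then have m: "m > 0" using measure_nonneg[of M1 "space M1"] by (simp add: m_def less_le)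
    let ?N = "\<lambda>M. density M (\<lambda>_::real. ennreal (1/m))"
    have em: "emeasure (?N M) A = ennreal (1/m) * emeasure M A" if "A \<in> sets M" for M A
      using that by (simp add: emeasure_density nn_integral_cmult_indicator)
    have dist: "real_distribution (?N M)" if "sets M = sets borel" "emeasure M (space M) = ennreal m" for M
    proof -
      have "prob_space (?N M)"
      proof (rule prob_spaceI)
        have "emeasure (?N M) (space (?N M)) = ennreal (1/m) * ennreal m"
          using em[OF sets.top, of M] that(2) by simp
        also have "\<dots> = 1" using m by (simp flip: ennreal_mult)
        finally show "emeasure (?N M) (space (?N M)) = 1" .
      qed
      then show ?thesis
        unfolding real_distribution_def real_distribution_axioms_def using that by simp
    qed
    have ch: "char (?N M) t = char M t / m" if [measurable_cong]: "sets M = sets borel" for M t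
      unfolding char_def by (subst integral_density) (use m in \<open>auto simp: scaleR_conv_of_real\<close>)
    have "?N M1 = ?N M2"
      by (rule Levy_uniqueness) (auto intro!: dist simp: m1e m2e assms ch fun_eq_iff)
    then have "ennreal (1/m) * emeasure M1 A = ennreal (1/m) * emeasure M2 A" if "A \<in> sets M1" for A
      using em[of A M1] em[of A M2] that by (simp add: assms)
    then have "ennreal m * (ennreal (1/m) * emeasure M1 A) = ennreal m * (ennreal (1/m) * emeasure M2 A)"
      if "A \<in> sets M1" for A using that by simp
    moreover have "ennreal m * ennreal (1/m) = 1"
      using m by (simp flip: ennreal_mult)
    ultimately have "emeasure M1 A = emeasure M2 A" if "A \<in> sets M1" for A
      using that by (simp flip: mult.assoc)
    then show ?thesis by (intro measure_eqI) (auto simp: assms)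
  qed
qed

text \<open>A Levy measure may be infinite near 0. An integrable weight makes it finite, and the
  weighted Fourier integrals are the characteristic functions of the weighted measures.\<close>

lemma density_eqI_char:
  fixes \<rho>1 \<rho>2 :: "real measure" and w :: "real \<Rightarrow> real"
  assumes [measurable_cong]: "sets \<rho>1 = sets borel" "sets \<rho>2 = sets borel"
    and w: "\<And>v. 0 \<le> w v" "integrable \<rho>1 w" "integrable \<rho>2 w"
    and eq: "\<And>u. (CLINT v|\<rho>1. w v *\<^sub>R iexp (u * v)) = (CLINT v|\<rho>2. w v *\<^sub>R iexp (u * v))"
  shows "density \<rho>1 w = density \<rho>2 w"
proof (rule finite_Levy_uniqueness)
  have fin: "finite_measure (density \<rho> w)" if "integrable \<rho> w" for \<rho>
  proof (rule finite_measureI)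
    have [measurable]: "w \<in> borel_measurable \<rho>" using that by auto
    show "emeasure (density \<rho> w) (space (density \<rho> w)) \<noteq> \<infinity>"
      using that w(1) by (simp add: emeasure_density nn_integral_eq_integral cong: nn_integral_cong)
  qed
  show "finite_measure (density \<rho>1 w)" "finite_measure (density \<rho>2 w)"
    using fin w by auto
  have [measurable]: "w \<in> borel_measurable \<rho>1" "w \<in> borel_measurable \<rho>2" using w by auto
  show "char (density \<rho>1 w) = char (density \<rho>2 w)"
    unfolding char_def by (rule ext, subst (1 2) integral_density) (use eq in \<open>auto simp: w\<close>)
qed (auto simp: assms)

text \<open>Second differences in \<open>u\<close> cancel the compensator, which is affine in
  \<open>u\<close>, and leave a Fourier integrand whose nonnegative weight is bounded and of order
  \<open>v\<^sup>2\<close> at 0.\<close>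

lemma compensated_exp_second_difference:
  "compensated_exp (- (\<i> * of_real (u + h))) v + compensated_exp (- (\<i> * of_real (u - h))) v
     - 2 * compensated_exp (- (\<i> * of_real u)) v = - ((2 - 2 * cos (h * v)) *\<^sub>R iexp (u * v))"
proof -
  have "iexp (h * v) + iexp (- (h * v)) = of_real (2 * cos (h * v))"
    by (simp only: exp_Euler exp_minus_Euler of_real_minus mult_minus_right) (simp flip: cos_of_real)
  moreover have "iexp ((u + h) * v) = iexp (u * v) * iexp (h * v)"
    "iexp ((u - h) * v) = iexp (u * v) * iexp (- (h * v))"
    by (simp_all add: algebra_simps flip: exp_add)
  ultimately have "iexp ((u + h) * v) + iexp ((u - h) * v) = iexp (u * v) * of_real (2 * cos (h * v))"
    by (simp add: distrib_left[symmetric])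
  then show ?thesis
    unfolding compensated_exp_imaginary by (simp add: scaleR_conv_of_real algebra_simps)
qed

text \<open>Jumps contribute less than quadratic growth to the exponent, so division by the square
  isolates the Gaussian coefficient.\<close>

lemma tendsto_integral_compensated_exp_div_square:
  assumes sets: "sets \<rho> = sets borel" and int: "integrable \<rho> (\<lambda>v. min \<bar>v\<bar> (v\<^sup>2))"
  shows "(\<lambda>n. (LINT v|\<rho>. compensated_exp (- (\<i> * of_real (real (Suc n)))) v) / of_real ((real (Suc n))\<^sup>2)) \<longlonglongrightarrow> 0"
proof -
  let ?f = "\<lambda>n v. compensated_exp (- (\<i> * of_real (real (Suc n)))) v / of_real ((real (Suc n))\<^sup>2)"
  have f: "norm (?f n v) = norm (compensated_exp (- (\<i> * of_real (real (Suc n)))) v) / (real (Suc n))\<^sup>2" for n v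
    by (simp add: norm_divide norm_power del: of_nat_Suc)
  have n: "norm (- (\<i> * of_real (real (Suc n)))) = real (Suc n)" for n
    by (simp add: norm_mult del: of_nat_Suc)
  have b: "norm (?f n v) \<le> (2 / real (Suc n) + 1) * min \<bar>v\<bar> (v\<^sup>2)" for n v
  proof -
    let ?u = "real (Suc n)"
    have "norm (?f n v) \<le> (2 * ?u + ?u\<^sup>2) * min \<bar>v\<bar> (v\<^sup>2) / ?u\<^sup>2"
      unfolding f using norm_compensated_exp_le[of "- (\<i> * of_real ?u)" v, unfolded n]
      by (intro divide_right_mono) auto
    also have "\<dots> = (2 / ?u + 1) * min \<bar>v\<bar> (v\<^sup>2)"
      by (simp add: power2_eq_square add_divide_distrib distrib_right del: of_nat_Suc)
    finally show ?thesis .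
  qed
  have "(\<lambda>n. LINT v|\<rho>. ?f n v) \<longlonglongrightarrow> (LINT v|\<rho>. 0)"
  \<comment> \<open>The combined bound has the factor \<open>2 / real (Suc n) + 1\<close>, which is
    at most 3 for all \<open>n\<close>.\<close>
  proof (rule integral_dominated_convergence[where w = "\<lambda>v. 3 * min \<bar>v\<bar> (v\<^sup>2)"])
    show "?f n \<in> borel_measurable \<rho>" for n
      by (simp add: measurable_cong_sets[OF sets refl] del: of_nat_Suc)
    show "AE v in \<rho>. norm (?f n v) \<le> 3 * min \<bar>v\<bar> (v\<^sup>2)" for n
    proof (rule AE_I2)
      fix v
      have "2 / real (Suc n) + 1 \<le> 3" by (simp add: field_simps)
      then have "(2 / real (Suc n) + 1) * min \<bar>v\<bar> (v\<^sup>2) \<le> 3 * min \<bar>v\<bar> (v\<^sup>2)"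
        by (intro mult_right_mono) auto
      then show "norm (?f n v) \<le> 3 * min \<bar>v\<bar> (v\<^sup>2)" using b[of n v] by linarith
    qed
    show "AE v in \<rho>. (\<lambda>n. ?f n v) \<longlonglongrightarrow> 0"
    proof (rule AE_I2)
      fix v
      \<comment> \<open>For fixed \<open>v\<close> it is the linear bound that decays after division
        by the square; the square bound would stay at \<open>v\<^sup>2\<close>.\<close>
      have "norm (?f n v) \<le> 2 * \<bar>v\<bar> * inverse (real (Suc n))" for n
      proof -
        let ?u = "real (Suc n)"
        have "norm (?f n v) \<le> 2 * ?u * \<bar>v\<bar> / ?u\<^sup>2"
          unfolding f using norm_compensated_exp_le_linear[of "- (\<i> * of_real ?u)" v, unfolded n]
          by (intro divide_right_mono) auto
        also have "\<dots> = 2 * \<bar>v\<bar> * inverse ?u"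
          by (simp add: power2_eq_square divide_inverse del: of_nat_Suc)
        finally show ?thesis .
      qed
      moreover have "(\<lambda>n. 2 * \<bar>v\<bar> * inverse (real (Suc n))) \<longlonglongrightarrow> 0"
        by (rule tendsto_mult_right_zero[OF LIMSEQ_inverse_real_of_nat])
      ultimately show "(\<lambda>n. ?f n v) \<longlonglongrightarrow> 0"
        by (rule Lim_null_comparison[OF always_eventually[OF allI]])
    qed
    show "integrable \<rho> (\<lambda>v. 3 * min \<bar>v\<bar> (v\<^sup>2))"
      using int by (rule integrable_mult_right)
  qed simp
  then show ?thesis by simp
qed

text \<open>The Gaussian coefficients are separated first, by growth; second differences of the then
  equal jump exponents identify the weighted measures. An atom at 0 leaves no trace in the exponent,
  hence \<open>0 \<notin> A\<close>.\<close>

lemma levy_khintchine_unique: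
  fixes q1 q2 :: real
  assumes [measurable_cong]: "sets \<rho>1 = sets borel" "sets \<rho>2 = sets borel"
    and int: "integrable \<rho>1 (\<lambda>v. min \<bar>v\<bar> (v\<^sup>2))" "integrable \<rho>2 (\<lambda>v. min \<bar>v\<bar> (v\<^sup>2))"
    and eq: "\<And>u. - of_real (q1 * u\<^sup>2 / 2) + (CLINT v|\<rho>1. iexp (u * v) - 1 - \<i> * of_real (u * v))
                = - of_real (q2 * u\<^sup>2 / 2) + (CLINT v|\<rho>2. iexp (u * v) - 1 - \<i> * of_real (u * v))"
  shows "q1 = q2"
    and "\<And>A. A \<in> sets borel \<Longrightarrow> 0 \<notin> A \<Longrightarrow> emeasure \<rho>1 A = emeasure \<rho>2 A"
proof -
  define \<Psi> where "\<Psi> = (\<lambda>\<rho> u. LINT v|\<rho>. compensated_exp (- (\<i> * of_real u)) v)"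
  have eq': "- of_real (q1 * u\<^sup>2 / 2) + \<Psi> \<rho>1 u = - of_real (q2 * u\<^sup>2 / 2) + \<Psi> \<rho>2 u" for u
    using eq[of u] unfolding \<Psi>_def compensated_exp_imaginary .
  \<comment> \<open>The constant sequence is a difference of two null sequences, so its value is
    0.\<close>
  have "(\<lambda>n. of_real (q1 - q2) / (2::complex)) \<longlonglongrightarrow> 0 - 0"
  proof (rule Lim_transform_eventually)
    show "(\<lambda>n. \<Psi> \<rho>1 (real (Suc n)) / of_real ((real (Suc n))\<^sup>2)
                - \<Psi> \<rho>2 (real (Suc n)) / of_real ((real (Suc n))\<^sup>2)) \<longlonglongrightarrow> 0 - 0"
      unfolding \<Psi>_def by (intro tendsto_diff tendsto_integral_compensated_exp_div_square assms)
    have "\<Psi> \<rho>1 u / of_real (u\<^sup>2) - \<Psi> \<rho>2 u / of_real (u\<^sup>2) = of_real (q1 - q2) / 2" if "u > 0" for u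
    proof -
      have "\<Psi> \<rho>1 u - \<Psi> \<rho>2 u = of_real (q1 * u\<^sup>2 / 2) - of_real (q2 * u\<^sup>2 / 2)"
        using eq'[of u] by (simp add: algebra_simps del: of_real_mult of_real_divide)
      also have "\<dots> = of_real ((q1 - q2) / 2) * of_real (u\<^sup>2)"
        by (simp only: diff_divide_distrib left_diff_distrib times_divide_eq_left of_real_diff of_real_mult of_real_divide)
      finally have "\<Psi> \<rho>1 u - \<Psi> \<rho>2 u = of_real ((q1 - q2) / 2) * of_real (u\<^sup>2)" .
      then show ?thesis using that by (simp add: diff_divide_distrib[symmetric] del: of_real_diff)
    qed
    from this[of "real (Suc _)"]
    show "\<forall>\<^sub>F n in sequentially. \<Psi> \<rho>1 (real (Suc n)) / of_real ((real (Suc n))\<^sup>2)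
                - \<Psi> \<rho>2 (real (Suc n)) / of_real ((real (Suc n))\<^sup>2) = of_real (q1 - q2) / 2"
      by (intro always_eventually) simp
  qed
  then show "q1 = q2"
    using LIMSEQ_unique[OF tendsto_const] by fastforce
  with eq' have \<Psi>_eq: "\<Psi> \<rho>1 u = \<Psi> \<rho>2 u" for u by simp
  \<comment> \<open>The second difference with step \<open>h\<close> does not see jumps in \<open>(2 * pi / h) \<int>\<close>; two
    incommensurable steps together see every nonzero jump.\<close>
  obtain c :: real where c: "c \<notin> \<rat>"
  proof -
    have "(\<rat> :: real set) \<noteq> UNIV"
      using uncountable_UNIV_real countable_rat by metis
    then show thesis using that by blast
  qed
  define w :: "real \<Rightarrow> real" where "w = (\<lambda>v. (2 - 2 * cos (1 * v)) + (2 - 2 * cos (c * v)))"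
  have [measurable]: "w \<in> borel_measurable borel" unfolding w_def by measurable
  have w0: "0 \<le> w v" for v
    using cos_le_one[of v] cos_le_one[of "c * v"] unfolding w_def mult_1 by linarith
  have wpos: "0 < w v" if "v \<noteq> 0" for v
  proof (rule ccontr)
    assume "\<not> 0 < w v"
    then have "cos v = 1" "cos (c * v) = 1"
      using cos_le_one[of v] cos_le_one[of "c * v"] unfolding w_def mult_1 by linarith+
    then obtain m n :: int where mn: "v = m * 2 * pi" "c * v = n * 2 * pi"
      by (auto simp: cos_one_2pi_int)
    then have "c * of_int m = of_int n" by simp
    moreover have "m \<noteq> 0" using that mn by auto
    ultimately have "c = of_int n / of_int m" by (simp add: eq_divide_eq)
    with c show False by simp
  qed
  have ice: "integrable \<rho> (compensated_exp (- (\<i> * of_real u)))"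
    if "sets \<rho> = sets borel" "integrable \<rho> (\<lambda>v. min \<bar>v\<bar> (v\<^sup>2))" for \<rho> u
    using that by (intro integrable_compensated_exp) auto
  have wl: "has_bochner_integral \<rho> (\<lambda>v. (2 - 2 * cos (h * v)) *\<^sub>R iexp (u * v))
       (2 * \<Psi> \<rho> u - \<Psi> \<rho> (u + h) - \<Psi> \<rho> (u - h))"
    if "sets \<rho> = sets borel" "integrable \<rho> (\<lambda>v. min \<bar>v\<bar> (v\<^sup>2))" for \<rho> u h
  proof -
    have "has_bochner_integral \<rho> (\<lambda>v. 2 * compensated_exp (- (\<i> * of_real u)) v
        - compensated_exp (- (\<i> * of_real (u + h))) v - compensated_exp (- (\<i> * of_real (u - h))) v)
       (2 * \<Psi> \<rho> u - \<Psi> \<rho> (u + h) - \<Psi> \<rho> (u - h))"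
      unfolding \<Psi>_def
      by (intro has_bochner_integral_diff has_bochner_integral_mult_right has_bochner_integral_integrable ice that)
    moreover have "2 * compensated_exp (- (\<i> * of_real u)) v
        - compensated_exp (- (\<i> * of_real (u + h))) v - compensated_exp (- (\<i> * of_real (u - h))) v
        = (2 - 2 * cos (h * v)) *\<^sub>R iexp (u * v)" for v
      using compensated_exp_second_difference[of u h v] by (simp add: algebra_simps)
    ultimately show ?thesis by simp
  qed
  have wi: "has_bochner_integral \<rho> (\<lambda>v. w v *\<^sub>R iexp (u * v))
       ((2 * \<Psi> \<rho> u - \<Psi> \<rho> (u + 1) - \<Psi> \<rho> (u - 1)) + (2 * \<Psi> \<rho> u - \<Psi> \<rho> (u + c) - \<Psi> \<rho> (u - c)))"
    if "sets \<rho> = sets borel" "integrable \<rho> (\<lambda>v. min \<bar>v\<bar> (v\<^sup>2))" for \<rho> u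
    using has_bochner_integral_add[OF wl[OF that, of 1 u] wl[OF that, of c u]]
    unfolding w_def scaleR_add_left by simp
  have w_int: "integrable \<rho> w"
    if "sets \<rho> = sets borel" "integrable \<rho> (\<lambda>v. min \<bar>v\<bar> (v\<^sup>2))" for \<rho>
  proof -
    have "integrable \<rho> (\<lambda>v. Re (w v *\<^sub>R iexp (0 * v)))"
      using wi[OF that, of 0] by (intro integrable_Re) (auto simp: has_bochner_integral_iff)
    then show ?thesis by simp
  qed
  have dens: "density \<rho>1 w = density \<rho>2 w"
  proof (rule density_eqI_char)
    show "(CLINT v|\<rho>1. w v *\<^sub>R iexp (u * v)) = (CLINT v|\<rho>2. w v *\<^sub>R iexp (u * v))" for u
      using has_bochner_integral_integral_eq[OF wi[OF assms(1,3)]]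
        has_bochner_integral_integral_eq[OF wi[OF assms(2,4)]] \<Psi>_eq by simp
  qed (use w0 w_int assms in auto)
  \<comment> \<open>The weight is positive away from 0, so dividing by it recovers the measure on
    sets that avoid 0.\<close>
  have em: "emeasure \<rho> A = (\<integral>\<^sup>+v. ennreal (1 / w v) * indicator A v \<partial>density \<rho> w)"
    if [measurable_cong]: "sets \<rho> = sets borel" and [measurable]: "A \<in> sets borel" and "0 \<notin> A" for \<rho> A
  proof -
    have "(\<integral>\<^sup>+v. ennreal (1 / w v) * indicator A v \<partial>density \<rho> w)
        = (\<integral>\<^sup>+v. ennreal (w v) * (ennreal (1 / w v) * indicator A v) \<partial>\<rho>)"
      by (rule nn_integral_density) measurable
    also have "\<dots> = (\<integral>\<^sup>+v. indicator A v \<partial>\<rho>)"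
    proof (rule nn_integral_cong)
      fix v
      show "ennreal (w v) * (ennreal (1 / w v) * indicator A v) = indicator A v"
      proof (cases "v \<in> A")
        case True
        then have "0 < w v" using wpos \<open>0 \<notin> A\<close> by metis
        then show ?thesis using True by (simp flip: ennreal_mult)
      qed simp
    qed
    finally show ?thesis using that by simp
  qed
  show "emeasure \<rho>1 A = emeasure \<rho>2 A" if "A \<in> sets borel" "0 \<notin> A" for A
    unfolding em[OF assms(1) that] em[OF assms(2) that] dens ..
qed

subsection \<open>From the Laplace exponent to the characteristic exponent\<close>

text \<open>Near \<open>z\<close> the real part of \<open>w\<close> stays between 0 and
  \<open>Re z + r\<close>. In the dominating function the summand 1 covers nonnegative values of
  \<open>X\<close>, the exponential the negative ones.\<close>

lemma Laplace_transform_holomorphic: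
  fixes X :: "'a \<Rightarrow> real"
  assumes M: "finite_measure M" and int: "\<And>\<beta>. 0 \<le> \<beta> \<Longrightarrow> integrable M (\<lambda>\<omega>. exp (- \<beta> * X \<omega>))"
    and [measurable]: "X \<in> borel_measurable M"
  shows "(\<lambda>z. LINT \<omega>|M. exp (- (z * of_real (X \<omega>)))) holomorphic_on {z. 0 < Re z}"
proof (rule holomorphic_on_integral)
  fix z :: complex assume z: "z \<in> {z. 0 < Re z}"
  obtain r where r: "r > 0" "cball z r \<subseteq> {z. 0 < Re z}"
    using z open_contains_cball[of "{z. 0 < Re z}"] open_halfspace_Re_gt by blast
  have "norm (exp (- (w * of_real (X \<omega>)))) \<le> 1 + exp (- (Re z + r) * X \<omega>)" if w: "w \<in> cball z r" for w \<omega>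
  proof -
    have pos: "0 < Re w" using w r by auto
    have le: "Re w \<le> Re z + r"
      using w abs_Re_le_cmod[of "w - z"] by (simp add: dist_norm norm_minus_commute)
    have "exp (- (Re w * X \<omega>)) \<le> 1 + exp (- (Re z + r) * X \<omega>)"
    proof (cases "0 \<le> X \<omega>")
      case True
      then have "exp (- (Re w * X \<omega>)) \<le> 1" using pos by simp
      then show ?thesis by (smt (verit) exp_ge_zero)
    next
      case False
      then have "exp (- (Re w * X \<omega>)) \<le> exp (- (Re z + r) * X \<omega>)"
        using mult_right_mono_neg[OF le, of "X \<omega>"] by (simp add: algebra_simps)
      then show ?thesis by linarith
    qed
    then show ?thesis by simp
  qed
  moreover have "integrable M (\<lambda>\<omega>. 1 + exp (- (Re z + r) * X \<omega>))"
    using int[of "Re z + r"] int[of 0] z r by (intro Bochner_Integration.integrable_add) auto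
  ultimately show "\<exists>r>0. \<exists>g::'a \<Rightarrow> real. cball z r \<subseteq> {z. 0 < Re z} \<and> integrable M g \<and>
      (AE \<omega> in M. \<forall>w\<in>cball z r. norm (exp (- (w * of_real (X \<omega>)))) \<le> g \<omega>)"
    using r by (intro exI[of _ r] exI[of _ "\<lambda>\<omega>. 1 + exp (- (Re z + r) * X \<omega>)"]) auto
qed (auto simp: open_halfspace_Re_gt intro!: holomorphic_intros)

text \<open>The transform \<open>L\<close> and the function \<open>exp (of_real t * K z)\<close> are
  holomorphic in the right half-plane and agree on the positive axis, hence throughout; boundary
  limits carry this to the imaginary axis. Comparing exponentials instead of exponents avoids a
  complex logarithm.\<close>

lemma char_from_Laplace_exponent:
  fixes X :: "real \<Rightarrow> 'w \<Rightarrow> real"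
  assumes M: "prob_space M" and lap: "has_laplace_exponent M X J"
    and sets: "sets \<rho> = sets borel" and int: "integrable \<rho> (\<lambda>v. min \<bar>v\<bar> (v\<^sup>2))"
    and pos: "AE v in \<rho>. 0 < v"
    and J: "\<And>\<beta>. 0 \<le> \<beta> \<Longrightarrow> J \<beta> = q * \<beta>\<^sup>2 / 2 + (LINT v|\<rho>. exp (- \<beta> * v) - 1 + \<beta> * v)"
    and t: "0 \<le> t"
  shows "(CLINT \<omega>|M. iexp (u * X t \<omega>)) = exp (of_real t *
     (- of_real (q * u\<^sup>2 / 2) + (CLINT v|\<rho>. iexp (u * v) - 1 - \<i> * of_real (u * v))))"
proof -
  let ?H = "{z::complex. 0 < Re z}"
  define L :: "complex \<Rightarrow> complex" where "L = (\<lambda>z. LINT \<omega>|M. exp (- (z * of_real (X t \<omega>))))"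
  define \<Psi> :: "complex \<Rightarrow> complex" where "\<Psi> = (\<lambda>z. LINT v|\<rho>. compensated_exp z v)"
  define K where "K = (\<lambda>z. of_real q * z\<^sup>2 / 2 + \<Psi> z)"
  have expint: "integrable M (\<lambda>\<omega>. exp (- \<beta> * X t \<omega>))"
    and explap: "(LINT \<omega>|M. exp (- \<beta> * X t \<omega>)) = exp (t * J \<beta>)" if "0 \<le> \<beta>" for \<beta>
    using lap t that unfolding has_laplace_exponent_def by auto
  \<comment> \<open>Measurability of \<open>X t\<close> is recovered from that of its integrable
    exponential.\<close>
  have "(\<lambda>\<omega>. - ln (exp (- 1 * X t \<omega>))) \<in> borel_measurable M"
    using borel_measurable_integrable[OF expint[of 1]] by measurable
  then have [measurable]: "X t \<in> borel_measurable M" by simp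
  have Lhol: "L holomorphic_on ?H"
    unfolding L_def using M expint
    by (intro Laplace_transform_holomorphic) (auto simp: prob_space_def)
  have \<Psi>hol: "\<Psi> holomorphic_on ?H"
    unfolding \<Psi>_def by (rule holomorphic_on_integral_compensated_exp[OF sets int pos])
  have LK: "L z - exp (of_real t * K z) = 0" if z: "z \<in> ?H" for z
  proof (rule analytic_continuation[of "\<lambda>z. L z - exp (of_real t * K z)" ?H "of_real ` {0<..}" 1])
    show "(\<lambda>z. L z - exp (of_real t * K z)) holomorphic_on ?H"
      unfolding K_def by (intro holomorphic_intros Lhol \<Psi>hol) simp
    show "open ?H" by (rule open_halfspace_Re_gt)
    show "connected ?H" by (rule convex_connected[OF convex_halfspace_Re_gt])
    show "(1::complex) islimpt of_real ` {0<..}"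
      unfolding islimpt_approachable
    proof (intro allI impI)
      fix e :: real assume e: "0 < e"
      show "\<exists>x'\<in>of_real ` {0<..}. x' \<noteq> (1::complex) \<and> dist x' 1 < e"
        using e by (intro bexI[of _ "of_real (1 + e/2)"] imageI) (auto simp: dist_norm norm_divide)
    qed
    fix z :: complex assume "z \<in> of_real ` {0<..}"
    then obtain \<beta> where z: "z = of_real \<beta>" "0 < \<beta>" by auto
    have "L z = (LINT \<omega>|M. of_real (exp (- \<beta> * X t \<omega>)))"
      unfolding L_def z by (simp flip: exp_of_real)
    also have "\<dots> = of_real (exp (t * J \<beta>))"
      unfolding integral_complex_of_real using explap z by simp
    also have "\<dots> = exp (of_real t * of_real (J \<beta>))" by (simp flip: exp_of_real)
    also have "of_real (J \<beta>) = K z"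
      unfolding K_def \<Psi>_def z compensated_exp_of_real integral_complex_of_real using J z by simp
    finally show "L z - exp (of_real t * K z) = 0" by simp
  qed (use that in auto)
  let ?z = "- (\<i> * of_real u) :: complex"
  \<comment> \<open>The boundary point \<open>?z\<close> is approached horizontally from the right.
    Real parts in \<open>(0, 1]\<close> allow the dominating function
    \<open>1 + exp (- 1 * X t \<omega>)\<close>, and moduli of at most
    \<open>1 + \<bar>u\<bar>\<close> give the one for the jump integral.\<close>
  define Z :: "nat \<Rightarrow> complex" where "Z = (\<lambda>n. of_real (inverse (real (Suc n))) + ?z)"
  have Zlim: "Z \<longlonglongrightarrow> ?z"
    unfolding Z_def using tendsto_add[OF tendsto_of_real[OF LIMSEQ_inverse_real_of_nat] tendsto_const[of ?z]] by simp
  have ReZ: "0 < Re (Z n)" "Re (Z n) \<le> 1" for n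
    unfolding Z_def by (auto simp: field_simps)
  have normZ: "norm (Z n) \<le> 1 + \<bar>u\<bar>" for n
  proof -
    have "inverse (real (Suc n)) \<le> 1" by (simp add: field_simps)
    then show ?thesis
      unfolding Z_def
      using norm_triangle_ineq[of "of_real (inverse (real (Suc n)))" ?z]
      by (simp add: norm_mult del: of_nat_Suc of_real_inverse)
  qed
  have "(\<lambda>n. L (Z n)) \<longlonglongrightarrow> L ?z"
    unfolding L_def
  proof (rule integral_dominated_convergence[where w = "\<lambda>\<omega>. 1 + exp (- 1 * X t \<omega>)"])
    show "integrable M (\<lambda>\<omega>. 1 + exp (- 1 * X t \<omega>))"
      using expint[of 0] expint[of 1] by (intro Bochner_Integration.integrable_add) auto
    show "AE \<omega> in M. (\<lambda>n. exp (- (Z n * of_real (X t \<omega>)))) \<longlonglongrightarrow> exp (- (?z * of_real (X t \<omega>)))"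
      by (intro AE_I2 tendsto_intros Zlim)
    show "AE \<omega> in M. norm (exp (- (Z n * of_real (X t \<omega>)))) \<le> 1 + exp (- 1 * X t \<omega>)" for n
    proof (rule AE_I2)
      fix \<omega>
      have "exp (- (Re (Z n) * X t \<omega>)) \<le> 1 + exp (- 1 * X t \<omega>)"
      proof (cases "0 \<le> X t \<omega>")
        case True
        then have "exp (- (Re (Z n) * X t \<omega>)) \<le> 1" using ReZ[of n] by simp
        then show ?thesis by (smt (verit) exp_ge_zero)
      next
        case False
        then have "exp (- (Re (Z n) * X t \<omega>)) \<le> exp (- 1 * X t \<omega>)"
          using mult_right_mono_neg[OF ReZ(2), of "X t \<omega>" n] by simp
        then show ?thesis by linarith
      qed
      then show "norm (exp (- (Z n * of_real (X t \<omega>)))) \<le> 1 + exp (- 1 * X t \<omega>)" by simp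
    qed
  qed measurable
  moreover have "(\<lambda>n. \<Psi> (Z n)) \<longlonglongrightarrow> \<Psi> ?z"
    unfolding \<Psi>_def
  proof (rule integral_dominated_convergence[where w = "\<lambda>v. (2 * (1 + \<bar>u\<bar>) + (1 + \<bar>u\<bar>)\<^sup>2) * min \<bar>v\<bar> (v\<^sup>2)"])
    show "AE v in \<rho>. (\<lambda>n. compensated_exp (Z n) v) \<longlonglongrightarrow> compensated_exp ?z v"
      unfolding compensated_exp_def by (intro AE_I2 tendsto_intros Zlim)
    show "AE v in \<rho>. norm (compensated_exp (Z n) v) \<le> (2 * (1 + \<bar>u\<bar>) + (1 + \<bar>u\<bar>)\<^sup>2) * min \<bar>v\<bar> (v\<^sup>2)" for n
      using pos
    proof eventually_elim
      case (elim v)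
      have "norm (compensated_exp (Z n) v) \<le> (2 * norm (Z n) + (norm (Z n))\<^sup>2) * min \<bar>v\<bar> (v\<^sup>2)"
        using ReZ(1)[of n] elim by (intro norm_compensated_exp_le) simp
      also have "\<dots> \<le> (2 * (1 + \<bar>u\<bar>) + (1 + \<bar>u\<bar>)\<^sup>2) * min \<bar>v\<bar> (v\<^sup>2)"
        using normZ[of n] by (intro mult_right_mono add_mono power_mono) auto
      finally show ?case .
    qed
  qed (use int in \<open>auto simp: measurable_cong_sets[OF sets refl]\<close>)
  then have "(\<lambda>n. exp (of_real t * K (Z n))) \<longlonglongrightarrow> exp (of_real t * K ?z)"
    unfolding K_def by (intro tendsto_intros Zlim) auto
  moreover have "L (Z n) = exp (of_real t * K (Z n))" for n
    using LK[of "Z n"] ReZ[of n] by simp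
  ultimately have "L ?z = exp (of_real t * K ?z)"
    using LIMSEQ_unique by fastforce
  then show ?thesis
    unfolding L_def K_def \<Psi>_def compensated_exp_imaginary by (simp add: power_mult_distrib mult.assoc)
qed

subsection \<open>The Laplace exponent of a stable measure\<close>

lemma stable_const_pos: "1 < \<alpha> \<Longrightarrow> \<alpha> < 2 \<Longrightarrow> 0 < stable_const \<alpha>"
  unfolding stable_const_def by (simp add: Gamma_real_pos)

text \<open>The substitution of \<open>v / s\<close> for \<open>v\<close> reduces this to Euler's
  Gamma integral.\<close>

lemma nn_integral_Gamma_scaled:
  assumes "0 < a" "0 < (s::real)"
  shows "(\<integral>\<^sup>+v. ennreal (v powr (a - 1) * exp (- s * v)) * indicator {0<..} v \<partial>lborel) = ennreal (Gamma a / s powr a)"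
proof -
  have "(\<integral>\<^sup>+v. ennreal (v powr (a - 1) * exp (- s * v)) * indicator {0<..} v \<partial>lborel)
      = ennreal \<bar>1/s\<bar> * (\<integral>\<^sup>+v. ennreal ((0 + 1/s * v) powr (a - 1) * exp (- s * (0 + 1/s * v))) * indicator {0<..} (0 + 1/s * v) \<partial>lborel)"
    by (rule nn_integral_real_affine) (use assms in auto)
  also have "(\<integral>\<^sup>+v. ennreal ((0 + 1/s * v) powr (a - 1) * exp (- s * (0 + 1/s * v))) * indicator {0<..} (0 + 1/s * v) \<partial>lborel)
      = (\<integral>\<^sup>+v. ennreal (1 / s powr (a - 1)) * ennreal (indicator {0..} v * v powr (a - 1) / exp v) \<partial>lborel)"
    by (rule nn_integral_cong)
      (use assms in \<open>auto simp: indicator_def powr_divide exp_minus divide_simps simp flip: ennreal_mult\<close>)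
  also have "\<dots> = ennreal (1 / s powr (a - 1)) * ennreal (Gamma a)"
    using assms by (simp add: nn_integral_cmult Gamma_conv_nn_integral_real)
  also have "ennreal \<bar>1/s\<bar> * \<dots> = ennreal (Gamma a / s powr a)"
    using assms by (simp add: powr_diff Gamma_real_pos less_imp_le flip: ennreal_mult)
  finally show ?thesis .
qed

text \<open>Taylor's formula in \<beta> about 0, where value and slope vanish; the remainder has a
  nonnegative integrand, ready for Tonelli.\<close>

lemma nn_integral_compensated_exp_Taylor:
  assumes "0 \<le> \<beta>"
  shows "ennreal (exp (- \<beta> * v) - 1 + \<beta> * v)
     = (\<integral>\<^sup>+s. ennreal ((\<beta> - s) * v\<^sup>2 * exp (- s * v)) * indicator {0..\<beta>} s \<partial>lborel)"
proof -
  \<comment> \<open>The antiderivative comes from one integration by parts in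
    \<open>s\<close>.\<close>
  have "(\<integral>\<^sup>+s. ennreal ((\<beta> - s) * v\<^sup>2 * exp (- s * v)) * indicator {0..\<beta>} s \<partial>lborel)
      = ennreal ((\<lambda>s. exp (- s * v) - (\<beta> - s) * v * exp (- s * v)) \<beta>
               - (\<lambda>s. exp (- s * v) - (\<beta> - s) * v * exp (- s * v)) 0)"
  proof (rule nn_integral_FTC_Icc)
    fix s assume s: "s \<in> {0..\<beta>}"
    show "((\<lambda>s. exp (- s * v) - (\<beta> - s) * v * exp (- s * v)) has_real_derivative
        (\<beta> - s) * v\<^sup>2 * exp (- s * v)) (at s)"
      by (rule derivative_eq_intros refl)+ (simp add: algebra_simps power2_eq_square)
    show "0 \<le> (\<beta> - s) * v\<^sup>2 * exp (- s * v)" using s by simp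
  qed (use assms in auto)
  then show ?thesis by (simp add: algebra_simps)
qed

text \<open>Taylor's formula with integral remainder and Tonelli's theorem reduce the claim to
  Gamma integrals.\<close>

lemma nn_integral_stable:
  assumes \<alpha>: "1 < \<alpha>" "\<alpha> < 2" and \<beta>: "0 \<le> \<beta>"
  shows "(\<integral>\<^sup>+v. ennreal ((exp (- \<beta> * v) - 1 + \<beta> * v) / v powr (1 + \<alpha>)) * indicator {0<..} v \<partial>lborel)
       = ennreal (stable_const \<alpha> * \<beta> powr \<alpha>)"
proof -
  let ?F = "\<lambda>v s. ennreal ((\<beta> - s) * (v powr (1 - \<alpha>) * exp (- s * v))) * indicator {0..\<beta>} s * indicator {0<..} v :: ennreal"
  have "(\<integral>\<^sup>+v. ennreal ((exp (- \<beta> * v) - 1 + \<beta> * v) / v powr (1 + \<alpha>)) * indicator {0<..} v \<partial>lborel)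
      = (\<integral>\<^sup>+v. (\<integral>\<^sup>+s. ?F v s \<partial>lborel) \<partial>lborel)"
  proof (rule nn_integral_cong)
    fix v :: real
    show "ennreal ((exp (- \<beta> * v) - 1 + \<beta> * v) / v powr (1 + \<alpha>)) * indicator {0<..} v = (\<integral>\<^sup>+s. ?F v s \<partial>lborel)"
    proof (cases "v > 0")
      case True
      have "ennreal ((exp (- \<beta> * v) - 1 + \<beta> * v) / v powr (1 + \<alpha>))
          = ennreal (1 / v powr (1 + \<alpha>)) * ennreal (exp (- \<beta> * v) - 1 + \<beta> * v)"
        by (simp flip: ennreal_mult')
      also have "\<dots> = (\<integral>\<^sup>+s. ennreal (1 / v powr (1 + \<alpha>)) * (ennreal ((\<beta> - s) * v\<^sup>2 * exp (- s * v)) * indicator {0..\<beta>} s) \<partial>lborel)"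
        unfolding nn_integral_compensated_exp_Taylor[OF \<beta>] by (rule nn_integral_cmult[symmetric]) measurable
      also have "\<dots> = (\<integral>\<^sup>+s. ?F v s \<partial>lborel)"
      proof (rule nn_integral_cong)
        fix s
        have "1 / v powr (1 + \<alpha>) * ((\<beta> - s) * v\<^sup>2 * exp (- s * v)) = (\<beta> - s) * (v powr (1 - \<alpha>) * exp (- s * v))"
          using True by (simp add: powr_add powr_diff power2_eq_square)
        then show "ennreal (1 / v powr (1 + \<alpha>)) * (ennreal ((\<beta> - s) * v\<^sup>2 * exp (- s * v)) * indicator {0..\<beta>} s) = ?F v s"
          using True by (simp add: ennreal_mult'[symmetric] mult.assoc[symmetric] split: split_indicator)
      qed
      finally show ?thesis using True by simp
    qed simp
  qed
  also have "\<dots> = (\<integral>\<^sup>+s. (\<integral>\<^sup>+v. ?F v s \<partial>lborel) \<partial>lborel)"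
    by (rule lborel_pair.Fubini'[symmetric]) measurable
  also have "\<dots> = (\<integral>\<^sup>+s. ennreal (Gamma (2 - \<alpha>)) * (ennreal (\<beta> * s powr (\<alpha> - 2) - s powr (\<alpha> - 1)) * indicator {0..\<beta>} s) \<partial>lborel)"
  proof (rule nn_integral_cong_AE)
    \<comment> \<open>At \<open>s = 0\<close> the inner integral has no exponential decay and
      diverges if \<beta> > 0, while the right-hand side is governed by \<open>0 powr x = 0\<close>;
      this single point is discarded.\<close>
    have "AE s in lborel. s \<noteq> (0::real)" by (rule AE_lborel_singleton)
    then show "AE s in lborel. (\<integral>\<^sup>+v. ?F v s \<partial>lborel) =
       ennreal (Gamma (2 - \<alpha>)) * (ennreal (\<beta> * s powr (\<alpha> - 2) - s powr (\<alpha> - 1)) * indicator {0..\<beta>} s)"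
    proof eventually_elim
      case (elim s)
      show ?case
      proof (cases "s \<in> {0..\<beta>}")
        case True
        then have s: "0 < s" "s \<le> \<beta>" using elim by auto
        have "(\<integral>\<^sup>+v. ?F v s \<partial>lborel) = (\<integral>\<^sup>+v. ennreal (\<beta> - s) * (ennreal (v powr ((2 - \<alpha>) - 1) * exp (- s * v)) * indicator {0<..} v) \<partial>lborel)"
          by (rule nn_integral_cong) (use s in \<open>auto simp: ennreal_mult split: split_indicator\<close>)
        also have "\<dots> = ennreal (\<beta> - s) * ennreal (Gamma (2 - \<alpha>) / s powr (2 - \<alpha>))"
          using \<alpha> s by (subst nn_integral_cmult) (auto simp: nn_integral_Gamma_scaled[of "2 - \<alpha>" s, simplified])
        also have "\<dots> = ennreal ((\<beta> - s) * (Gamma (2 - \<alpha>) / s powr (2 - \<alpha>)))"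
          using s by (intro ennreal_mult'[symmetric]) simp
        also have "(\<beta> - s) * (Gamma (2 - \<alpha>) / s powr (2 - \<alpha>)) = Gamma (2 - \<alpha>) * (\<beta> * s powr (\<alpha> - 2) - s powr (\<alpha> - 1))"
          using s by (simp add: powr_diff power2_eq_square field_simps)
        also have "ennreal \<dots> = ennreal (Gamma (2 - \<alpha>)) * ennreal (\<beta> * s powr (\<alpha> - 2) - s powr (\<alpha> - 1))"
          using \<alpha> by (intro ennreal_mult') (auto simp: Gamma_real_pos less_imp_le)
        finally show ?thesis using True by simp
      qed simp
    qed
  qed
  also have "\<dots> = ennreal (Gamma (2 - \<alpha>)) * (\<integral>\<^sup>+s. ennreal (\<beta> * s powr (\<alpha> - 2) - s powr (\<alpha> - 1)) * indicator {0..\<beta>} s \<partial>lborel)"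
    by (rule nn_integral_cmult) measurable
  \<comment> \<open>The singularity of \<open>s powr (\<alpha> - 2)\<close> at 0 is integrable
    because \<alpha> > 1.\<close>
  also have "(\<integral>\<^sup>+s. ennreal (\<beta> * s powr (\<alpha> - 2) - s powr (\<alpha> - 1)) * indicator {0..\<beta>} s \<partial>lborel)
      = ennreal (\<beta> * (\<beta> powr (\<alpha> - 2 + 1) / (\<alpha> - 2 + 1)) - \<beta> powr (\<alpha> - 1 + 1) / (\<alpha> - 1 + 1))"
  proof (rule nn_integral_has_integral_lebesgue')
    show "0 \<le> \<beta> * s powr (\<alpha> - 2) - s powr (\<alpha> - 1)" if "s \<in> {0..\<beta>}" for s
    proof (cases "s = 0")
      case False
      then have "s powr (\<alpha> - 1) = s * s powr (\<alpha> - 2)" using that by (simp add: powr_diff power2_eq_square)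
      then show ?thesis using that by (simp add: mult_right_mono)
    qed simp
    show "((\<lambda>s. \<beta> * s powr (\<alpha> - 2) - s powr (\<alpha> - 1)) has_integral
       \<beta> * (\<beta> powr (\<alpha> - 2 + 1) / (\<alpha> - 2 + 1)) - \<beta> powr (\<alpha> - 1 + 1) / (\<alpha> - 1 + 1)) {0..\<beta>}"
      using \<alpha> \<beta> by (intro has_integral_diff has_integral_mult_right has_integral_powr_from_0) auto
  qed
  also have "ennreal (Gamma (2 - \<alpha>)) * \<dots> = ennreal (Gamma (2 - \<alpha>) * (\<beta> * (\<beta> powr (\<alpha> - 2 + 1) / (\<alpha> - 2 + 1)) - \<beta> powr (\<alpha> - 1 + 1) / (\<alpha> - 1 + 1)))"
    using \<alpha> by (intro ennreal_mult'[symmetric]) (auto simp: Gamma_real_pos less_imp_le)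
  also have "Gamma (2 - \<alpha>) * (\<beta> * (\<beta> powr (\<alpha> - 2 + 1) / (\<alpha> - 2 + 1)) - \<beta> powr (\<alpha> - 1 + 1) / (\<alpha> - 1 + 1)) = stable_const \<alpha> * \<beta> powr \<alpha>"
  proof (cases "\<beta> = 0")
    case False
    then have "\<beta> * \<beta> powr (\<alpha> - 1) = \<beta> powr \<alpha>" using \<beta> by (simp add: powr_diff)
    \<comment> \<open>The two primitives combine to the denominator of
      \<open>stable_const\<close>.\<close>
    moreover have "1 / (\<alpha> - 1) - 1 / \<alpha> = 1 / (\<alpha> * (\<alpha> - 1))" using \<alpha> by (simp add: divide_simps)
    then have "p / (\<alpha> - 1) - p / \<alpha> = p / (\<alpha> * (\<alpha> - 1))" for p
      by (metis (no_types) mult.right_neutral right_diff_distrib times_divide_eq_right)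
    ultimately show ?thesis unfolding stable_const_def by simp
  qed simp
  finally show ?thesis .
qed

text \<open>A converse to the upper bounds: a finite Laplace exponent at 1 makes
  \<open>min v (v\<^sup>2)\<close> integrable. The constant 4 comes from the lower bounds
  \<open>x\<^sup>2 / 4\<close> on \<open>[0, 1]\<close> and \<open>x / 4\<close> beyond 1.\<close>

lemma min_le_compensated_exp:
  assumes "0 \<le> (v::real)"
  shows "min v (v\<^sup>2) \<le> 4 * (exp (- v) - 1 + v)"
proof -
  have e: "exp (- x) \<le> 1 / (1 + x)" if "0 \<le> x" for x :: real
    using exp_ge_add_one_self[of x] that by (simp add: exp_minus divide_simps)
  have 1: "x\<^sup>2 / 4 \<le> exp (- x) - 1 + x" if x: "0 \<le> x" "x \<le> 1" for x :: real
  proof -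
    have "(\<lambda>x. exp (- x) - 1 + x - x\<^sup>2 / 4) 0 \<le> (\<lambda>x. exp (- x) - 1 + x - x\<^sup>2 / 4) x"
    proof (rule DERIV_nonneg_imp_nondecreasing[OF x(1)])
      fix y assume y: "0 \<le> y" "y \<le> x"
      have "1 / (1 + y) \<le> 1 - y / 2"
      proof -
        have "y * y \<le> y * 1" using x y by (intro mult_left_mono) auto
        then show ?thesis using y by (simp add: field_simps)
      qed
      then have "0 \<le> 1 - exp (- y) - y / 2" using e[OF y(1)] by linarith
      moreover have "((\<lambda>x. exp (- x) - 1 + x - x\<^sup>2 / 4) has_real_derivative (1 - exp (- y) - y / 2)) (at y)"
        by (auto intro!: derivative_eq_intros)
      ultimately show "\<exists>d. ((\<lambda>x. exp (- x) - 1 + x - x\<^sup>2 / 4) has_real_derivative d) (at y) \<and> 0 \<le> d" by blast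
    qed
    then show ?thesis by simp
  qed
  show ?thesis
  proof (cases "v \<le> 1")
    case True
    then show ?thesis using 1[of v] assms by (intro min.coboundedI2) (auto simp: field_simps)
  next
    case False
    then have "1 \<le> v" by simp
    \<comment> \<open>The quadratic bound at 1 is the starting value; from there on the slope
      \<open>1 - exp (- y)\<close> is at least \<open>1 / 2\<close>, more than the required
      \<open>1 / 4\<close>.\<close>
    have "(\<lambda>x. exp (- x) - 1 + x - x / 4) 1 \<le> (\<lambda>x. exp (- x) - 1 + x - x / 4) v"
    proof (rule DERIV_nonneg_imp_nondecreasing[OF \<open>1 \<le> v\<close>])
      fix y :: real assume y: "1 \<le> y" "y \<le> v"
      have "1 / (1 + y) \<le> 1 / 2" using y by (simp add: field_simps)
      then have "0 \<le> 1 - exp (- y) - 1 / 4" using e[of y] y by linarith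
      moreover have "((\<lambda>x. exp (- x) - 1 + x - x / 4) has_real_derivative (1 - exp (- y) - 1 / 4)) (at y)"
        by (auto intro!: derivative_eq_intros)
      ultimately show "\<exists>d. ((\<lambda>x. exp (- x) - 1 + x - x / 4) has_real_derivative d) (at y) \<and> 0 \<le> d" by blast
    qed
    then have "v \<le> 4 * (exp (- v) - 1 + v)" using 1[of 1] by simp
    then show ?thesis by (rule min.coboundedI1)
  qed
qed

subsection \<open>Mixtures of stable measures and the jump measure\<close>

lemma emeasure_stable_measure:
  assumes [measurable]: "A \<in> sets borel" and "A \<subseteq> {0<..}"
  shows "emeasure (stable_measure d \<alpha>) A = (\<integral>\<^sup>+v. ennreal (d / v powr (1 + \<alpha>)) * indicator A v \<partial>lborel)"
proof -
  have "A \<in> sets (restrict_space lborel {0<..})"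
    using assms by (auto simp: sets_restrict_space_iff)
  moreover have "(\<lambda>v. ennreal (d / v powr (1 + \<alpha>))) \<in> borel_measurable (restrict_space lborel {0<..})"
    by (rule measurable_restrict_space1) measurable
  ultimately have "emeasure (stable_measure d \<alpha>) A
      = (\<integral>\<^sup>+v. ennreal (d / v powr (1 + \<alpha>)) * indicator A v * indicator {0<..} v \<partial>lborel)"
    unfolding stable_measure_def by (subst emeasure_density) (auto simp: nn_integral_restrict_space)
  also have "\<dots> = (\<integral>\<^sup>+v. ennreal (d / v powr (1 + \<alpha>)) * indicator A v \<partial>lborel)"
    using assms(2) by (intro nn_integral_cong) (auto split: split_indicator)
  finally show ?thesis .
qed

text \<open>Unlike \<open>stable_measure\<close>, this lives on all Borel sets of the line, because
  the uniqueness result compares measures there; the indicator keeps the half-line up to 0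
  null.\<close>

definition stable_mixture :: "'k set \<Rightarrow> ('k \<Rightarrow> real) \<Rightarrow> ('k \<Rightarrow> real) \<Rightarrow> real measure" where
  "stable_mixture I \<eta> \<alpha> =
     density lborel (\<lambda>v. \<Sum>k\<in>I. ennreal (\<eta> k / stable_const (\<alpha> k) / v powr (1 + \<alpha> k)) * indicator {0<..} v)"

lemma sets_stable_mixture [simp]: "sets (stable_mixture I \<eta> \<alpha>) = sets borel"
  by (simp add: stable_mixture_def)

lemma AE_stable_mixture_pos: "AE v in stable_mixture I \<eta> \<alpha>. 0 < v"
  unfolding stable_mixture_def
  by (subst AE_density) (auto intro!: AE_I2 simp: indicator_def)

lemma nn_integral_stable_mixture:
  assumes [measurable]: "f \<in> borel_measurable borel"
  shows "(\<integral>\<^sup>+v. f v \<partial>stable_mixture I \<eta> \<alpha>)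
     = (\<Sum>k\<in>I. \<integral>\<^sup>+v. ennreal (\<eta> k / stable_const (\<alpha> k) / v powr (1 + \<alpha> k)) * indicator {0<..} v * f v \<partial>lborel)"
  unfolding stable_mixture_def
  by (subst nn_integral_density) (auto simp: sum_distrib_right nn_integral_sum)

lemma emeasure_stable_mixture:
  assumes [measurable]: "A \<in> sets borel" and A: "A \<subseteq> {0<..}"
  shows "emeasure (stable_mixture I \<eta> \<alpha>) A = (\<Sum>k\<in>I. emeasure (stable_measure (\<eta> k / stable_const (\<alpha> k)) (\<alpha> k)) A)"
proof -
  have "emeasure (stable_mixture I \<eta> \<alpha>) A = (\<integral>\<^sup>+v. indicator A v \<partial>stable_mixture I \<eta> \<alpha>)"
    by simp
  also have "\<dots> = (\<Sum>k\<in>I. emeasure (stable_measure (\<eta> k / stable_const (\<alpha> k)) (\<alpha> k)) A)"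
    unfolding nn_integral_stable_mixture[OF borel_measurable_indicator[OF assms(1)]] emeasure_stable_measure[OF assms]
    using A by (intro sum.cong nn_integral_cong refl) (auto split: split_indicator)
  finally show ?thesis .
qed

context
  fixes I :: "'k set" and \<eta> \<alpha> :: "'k \<Rightarrow> real"
  assumes I: "\<And>k. k \<in> I \<Longrightarrow> 0 \<le> \<eta> k \<and> 1 < \<alpha> k \<and> \<alpha> k < 2"
begin

text \<open>The division of \<open>\<eta> k\<close> by \<open>stable_const (\<alpha> k)\<close> in
  the density cancels exactly the constant produced by \<open>nn_integral_stable\<close>.\<close>

lemma nn_integral_compensated_stable_mixture:
  assumes \<beta>: "0 \<le> \<beta>"
  shows "(\<integral>\<^sup>+v. ennreal (exp (- \<beta> * v) - 1 + \<beta> * v) \<partial>stable_mixture I \<eta> \<alpha>) = ennreal (\<Sum>k\<in>I. \<eta> k * \<beta> powr \<alpha> k)"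
proof -
  have "(\<integral>\<^sup>+v. ennreal (exp (- \<beta> * v) - 1 + \<beta> * v) \<partial>stable_mixture I \<eta> \<alpha>)
    = (\<Sum>k\<in>I. \<integral>\<^sup>+v. ennreal (\<eta> k / stable_const (\<alpha> k) / v powr (1 + \<alpha> k)) * indicator {0<..} v * ennreal (exp (- \<beta> * v) - 1 + \<beta> * v) \<partial>lborel)"
    by (rule nn_integral_stable_mixture) measurable
  also have "\<dots> = (\<Sum>k\<in>I. ennreal (\<eta> k * \<beta> powr \<alpha> k))"
  proof (rule sum.cong[OF refl])
    fix k assume k: "k \<in> I"
    have c: "0 < stable_const (\<alpha> k)" using I[OF k] stable_const_pos by blast
    have "(\<integral>\<^sup>+v. ennreal (\<eta> k / stable_const (\<alpha> k) / v powr (1 + \<alpha> k)) * indicator {0<..} v * ennreal (exp (- \<beta> * v) - 1 + \<beta> * v) \<partial>lborel)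
      = (\<integral>\<^sup>+v. ennreal (\<eta> k / stable_const (\<alpha> k)) *
            (ennreal ((exp (- \<beta> * v) - 1 + \<beta> * v) / v powr (1 + \<alpha> k)) * indicator {0<..} v) \<partial>lborel)"
    proof (rule nn_integral_cong)
      fix v
      have "ennreal (\<eta> k / stable_const (\<alpha> k) / v powr (1 + \<alpha> k)) * ennreal (exp (- \<beta> * v) - 1 + \<beta> * v)
          = ennreal (\<eta> k / stable_const (\<alpha> k)) * ennreal ((exp (- \<beta> * v) - 1 + \<beta> * v) / v powr (1 + \<alpha> k))"
        using I[OF k] c by (simp flip: ennreal_mult')
      then show "ennreal (\<eta> k / stable_const (\<alpha> k) / v powr (1 + \<alpha> k)) * indicator {0<..} v * ennreal (exp (- \<beta> * v) - 1 + \<beta> * v)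
        = ennreal (\<eta> k / stable_const (\<alpha> k)) * (ennreal ((exp (- \<beta> * v) - 1 + \<beta> * v) / v powr (1 + \<alpha> k)) * indicator {0<..} v)"
        by (simp split: split_indicator)
    qed
    also have "\<dots> = ennreal (\<eta> k / stable_const (\<alpha> k)) * ennreal (stable_const (\<alpha> k) * \<beta> powr \<alpha> k)"
      using I[OF k] by (simp add: nn_integral_cmult nn_integral_stable[OF _ _ \<beta>, simplified])
    also have "\<dots> = ennreal (\<eta> k * \<beta> powr \<alpha> k)"
      using I[OF k] c by (simp flip: ennreal_mult')
    finally show "(\<integral>\<^sup>+v. ennreal (\<eta> k / stable_const (\<alpha> k) / v powr (1 + \<alpha> k)) * indicator {0<..} v * ennreal (exp (- \<beta> * v) - 1 + \<beta> * v) \<partial>lborel)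
      = ennreal (\<eta> k * \<beta> powr \<alpha> k)" .
  qed
  also have "\<dots> = ennreal (\<Sum>k\<in>I. \<eta> k * \<beta> powr \<alpha> k)"
    using I by (intro sum_ennreal) auto
  finally show ?thesis .
qed

lemma integral_compensated_stable_mixture:
  assumes \<beta>: "0 \<le> \<beta>"
  shows "(LINT v|stable_mixture I \<eta> \<alpha>. exp (- \<beta> * v) - 1 + \<beta> * v) = (\<Sum>k\<in>I. \<eta> k * \<beta> powr \<alpha> k)"
proof -
  have "0 \<le> exp (- \<beta> * v) - 1 + \<beta> * v" for v
    using exp_ge_add_one_self[of "- \<beta> * v"] by simp
  then have "(LINT v|stable_mixture I \<eta> \<alpha>. exp (- \<beta> * v) - 1 + \<beta> * v)
      = enn2real (\<integral>\<^sup>+v. ennreal (exp (- \<beta> * v) - 1 + \<beta> * v) \<partial>stable_mixture I \<eta> \<alpha>)"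
    by (intro integral_eq_nn_integral) (auto simp: measurable_cong_sets[OF sets_stable_mixture refl])
  also have "\<dots> = (\<Sum>k\<in>I. \<eta> k * \<beta> powr \<alpha> k)"
    unfolding nn_integral_compensated_stable_mixture[OF \<beta>]
    using I by (intro enn2real_ennreal sum_nonneg) auto
  finally show ?thesis .
qed

text \<open>The function is almost everywhere at most four times the compensated exponential at
  \<beta> = 1, whose integral is finite by the preceding computation.\<close>

lemma integrable_min_stable_mixture: "integrable (stable_mixture I \<eta> \<alpha>) (\<lambda>v. min \<bar>v\<bar> (v\<^sup>2))"
proof (rule integrableI_bounded)
  show "(\<lambda>v. min \<bar>v\<bar> (v\<^sup>2)) \<in> borel_measurable (stable_mixture I \<eta> \<alpha>)"
    by (simp add: measurable_cong_sets[OF sets_stable_mixture refl])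
  have "(\<integral>\<^sup>+v. ennreal (norm (min \<bar>v\<bar> (v\<^sup>2))) \<partial>stable_mixture I \<eta> \<alpha>)
      \<le> (\<integral>\<^sup>+v. ennreal 4 * ennreal (exp (- 1 * v) - 1 + 1 * v) \<partial>stable_mixture I \<eta> \<alpha>)"
  proof (rule nn_integral_mono_AE)
    show "AE v in stable_mixture I \<eta> \<alpha>. ennreal (norm (min \<bar>v\<bar> (v\<^sup>2))) \<le> ennreal 4 * ennreal (exp (- 1 * v) - 1 + 1 * v)"
      using AE_stable_mixture_pos
    proof eventually_elim
      case (elim v)
      then have "norm (min \<bar>v\<bar> (v\<^sup>2)) \<le> 4 * (exp (- 1 * v) - 1 + 1 * v)"
        using min_le_compensated_exp[of v] by (simp add: abs_if min_def split: if_splits)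
      then show ?case by (subst ennreal_mult'[symmetric]) (auto intro: ennreal_leI)
    qed
  qed
  also have "\<dots> = ennreal 4 * (\<integral>\<^sup>+v. ennreal (exp (- 1 * v) - 1 + 1 * v) \<partial>stable_mixture I \<eta> \<alpha>)"
    by (rule nn_integral_cmult) (simp add: measurable_cong_sets[OF sets_stable_mixture refl])
  also have "\<dots> < \<infinity>"
    unfolding nn_integral_compensated_stable_mixture[OF zero_le_one] by (simp add: ennreal_mult_less_top)
  finally show "(\<integral>\<^sup>+v. ennreal (norm (min \<bar>v\<bar> (v\<^sup>2))) \<partial>stable_mixture I \<eta> \<alpha>) < \<infinity>" .
qed

end

text \<open>Using all times \<open>t\<close> at once replaces a continuous choice of complex logarithm.\<close>

lemma exp_of_real_mult_inject:
  fixes a b :: complex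
  assumes "\<And>t. 0 \<le> t \<Longrightarrow> exp (of_real t * a) = exp (of_real t * b)"
  shows "a = b"
proof (rule ccontr)
  assume "a \<noteq> b"
  \<comment> \<open>The choice \<open>t = 1 / norm (a - b)\<close> gives a number of norm 1 with
    exponential 1. Such a number is an integer multiple of \<open>2 * pi * \<i>\<close>, so its norm
    is 0 or at least \<open>2 * pi\<close>.\<close>
  define z where "z = of_real (1 / norm (a - b)) * (a - b)"
  have "exp z = exp (of_real (1 / norm (a - b)) * a) / exp (of_real (1 / norm (a - b)) * b)"
    unfolding z_def right_diff_distrib by (rule exp_diff)
  also have "\<dots> = 1"
    using assms[of "1 / norm (a - b)"] by simp
  finally obtain n :: int where n: "Re z = 0" "Im z = of_int (2 * n) * pi"
    unfolding exp_eq_1 by blast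
  have "norm z = 1"
    unfolding z_def using \<open>a \<noteq> b\<close> by (simp add: norm_mult norm_divide)
  moreover have "norm z = \<bar>Im z\<bar>"
    unfolding cmod_def n(1) by simp
  ultimately have "of_int (2 * \<bar>n\<bar>) * pi = 1"
    unfolding n(2) by (simp add: abs_mult)
  moreover have "n = 0 \<or> 1 \<le> \<bar>n\<bar>" by linarith
  then have "of_int (2 * \<bar>n\<bar>) * pi = 0 \<or> 2 * pi \<le> of_int (2 * \<bar>n\<bar>) * pi" by auto
  ultimately show False using pi_gt3 by linarith
qed

text \<open>The exponent of \<open>g \<bullet> Z\<close> is computed twice: from the Levy-Khintchine
  formula of \<open>Z\<close> along the direction \<open>g\<close>, and from any pair
  \<open>q\<close>, \<open>\<rho>\<close> that represents \<open>J\<close>. Since \<open>A\<close>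
  may contain negative numbers, the image measure is also seen to have no mass below 0.\<close>

lemma image_levy_measure_unique:
  fixes Z :: "real \<Rightarrow> 'w \<Rightarrow> real ^ 'd" and g :: "real ^ 'd"
  assumes M: "prob_space M" and W: "wiener_cov_levy_measure M Z Q \<nu>"
    and lap: "has_laplace_exponent M (\<lambda>t \<omega>. g \<bullet> Z t \<omega>) J"
    and sets: "sets \<rho> = sets borel" and int: "integrable \<rho> (\<lambda>v. min \<bar>v\<bar> (v\<^sup>2))"
    and pos: "AE v in \<rho>. 0 < v"
    and J: "\<And>\<beta>. 0 \<le> \<beta> \<Longrightarrow> J \<beta> = q * \<beta>\<^sup>2 / 2 + (LINT v|\<rho>. exp (- \<beta> * v) - 1 + \<beta> * v)"
    and A: "A \<in> sets borel" "0 \<notin> A"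
  shows "emeasure (image_levy_measure \<nu> g) A = emeasure \<rho> A"
proof -
  let ?N = "image_levy_measure \<nu> g"
  have [measurable_cong]: "sets \<nu> = sets borel"
    and fin: "(\<integral>\<^sup>+ y. ennreal (min (norm y) ((norm y)\<^sup>2)) \<partial>\<nu>) < \<infinity>"
    and char: "\<And>t u. 0 \<le> t \<Longrightarrow> (CLINT \<omega>|M. iexp (u \<bullet> Z t \<omega>)) =
          exp (of_real t * (- of_real ((Q *v u) \<bullet> u / 2) +
             (CLINT y|\<nu>. iexp (u \<bullet> y) - 1 - \<i> * of_real (u \<bullet> y))))"
    using W unfolding wiener_cov_levy_measure_def by auto
  have g [measurable]: "(\<lambda>y. g \<bullet> y) \<in> measurable \<nu> borel" by measurable
  have setsN: "sets ?N = sets borel" by (simp add: image_levy_measure_def)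
  have intN: "integrable ?N (\<lambda>v. min \<bar>v\<bar> (v\<^sup>2))"
  proof -
    have "integrable \<nu> (\<lambda>y. min (norm y) ((norm y)\<^sup>2))"
      using fin by (intro integrableI_nonneg) auto
    \<comment> \<open>The factor adds the Cauchy-Schwarz constants of the linear and the quadratic
      term, so it serves whichever of them realises the minimum.\<close>
    then have "integrable \<nu> (\<lambda>y. (norm g + (norm g)\<^sup>2) * min (norm y) ((norm y)\<^sup>2))" by simp
    then have "integrable \<nu> (\<lambda>y. min \<bar>g \<bullet> y\<bar> ((g \<bullet> y)\<^sup>2))"
    proof (rule Bochner_Integration.integrable_bound)
      show "AE y in \<nu>. norm (min \<bar>g \<bullet> y\<bar> ((g \<bullet> y)\<^sup>2)) \<le> norm ((norm g + (norm g)\<^sup>2) * min (norm y) ((norm y)\<^sup>2))"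
      proof (rule AE_I2)
        fix y
        have 1: "\<bar>g \<bullet> y\<bar> \<le> norm g * norm y" by (rule Cauchy_Schwarz_ineq2)
        have 2: "(g \<bullet> y)\<^sup>2 \<le> (norm g)\<^sup>2 * (norm y)\<^sup>2"
          using power_mono[OF 1, of 2] by (simp add: power_mult_distrib)
        have "min \<bar>g \<bullet> y\<bar> ((g \<bullet> y)\<^sup>2) \<le> (norm g + (norm g)\<^sup>2) * min (norm y) ((norm y)\<^sup>2)"
        proof (cases "norm y \<le> (norm y)\<^sup>2")
          case True
          have "\<bar>g \<bullet> y\<bar> \<le> (norm g + (norm g)\<^sup>2) * norm y"
            using 1 by (simp add: distrib_right add_increasing2)
          then show ?thesis using True by (simp add: min.coboundedI1)
        next
          case False
          have "(g \<bullet> y)\<^sup>2 \<le> (norm g + (norm g)\<^sup>2) * (norm y)\<^sup>2"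
            using 2 by (simp add: distrib_right add_increasing)
          then show ?thesis using False by (simp add: min.coboundedI2)
        qed
        then show "norm (min \<bar>g \<bullet> y\<bar> ((g \<bullet> y)\<^sup>2)) \<le> norm ((norm g + (norm g)\<^sup>2) * min (norm y) ((norm y)\<^sup>2))"
          by simp
      qed
    qed measurable
    then show ?thesis
      unfolding image_levy_measure_def by (subst integrable_distr_eq) auto
  qed
  have "- of_real ((Q *v g) \<bullet> g * u\<^sup>2 / 2) + (CLINT v|?N. iexp (u * v) - 1 - \<i> * of_real (u * v))
      = - of_real (q * u\<^sup>2 / 2) + (CLINT v|\<rho>. iexp (u * v) - 1 - \<i> * of_real (u * v))" for u
  proof (rule exp_of_real_mult_inject)
    fix t :: real assume t: "0 \<le> t"
    \<comment> \<open>Frequency \<open>u\<close> for the image measure is frequency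
      \<open>u *\<^sub>R g\<close> for \<open>\<nu>\<close>.\<close>
    have N: "(CLINT v|?N. iexp (u * v) - 1 - \<i> * of_real (u * v))
        = (CLINT y|\<nu>. iexp ((u *\<^sub>R g) \<bullet> y) - 1 - \<i> * of_real ((u *\<^sub>R g) \<bullet> y))"
      unfolding image_levy_measure_def by (subst integral_distr[OF g]) auto
    have q: "(Q *v g) \<bullet> g * u\<^sup>2 / 2 = (Q *v (u *\<^sub>R g)) \<bullet> (u *\<^sub>R g) / 2"
      by (simp add: matrix_vector_mult_scaleR power2_eq_square)
    have "exp (of_real t * (- of_real ((Q *v g) \<bullet> g * u\<^sup>2 / 2) + (CLINT v|?N. iexp (u * v) - 1 - \<i> * of_real (u * v))))
        = (CLINT \<omega>|M. iexp ((u *\<^sub>R g) \<bullet> Z t \<omega>))"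
      unfolding N q char[OF t] ..
    also have "\<dots> = (CLINT \<omega>|M. iexp (u * (g \<bullet> Z t \<omega>)))" by simp
    also have "\<dots> = exp (of_real t * (- of_real (q * u\<^sup>2 / 2) + (CLINT v|\<rho>. iexp (u * v) - 1 - \<i> * of_real (u * v))))"
      by (rule char_from_Laplace_exponent[OF M lap sets int pos J t])
    finally show "exp (of_real t * (- of_real ((Q *v g) \<bullet> g * u\<^sup>2 / 2) + (CLINT v|?N. iexp (u * v) - 1 - \<i> * of_real (u * v))))
        = exp (of_real t * (- of_real (q * u\<^sup>2 / 2) + (CLINT v|\<rho>. iexp (u * v) - 1 - \<i> * of_real (u * v))))" .
  qed
  from levy_khintchine_unique(2)[OF setsN sets intN int this A] show ?thesis .
qed

theorem corollary3p2:
  fixes M :: "'w measure"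
    and Filt :: "real \<Rightarrow> 'w measure"
    and Z :: "real \<Rightarrow> 'w \<Rightarrow> real ^ 'd"
    and Fd :: "real \<Rightarrow> real"
    and G :: "real \<Rightarrow> real ^ 'd"
    and J :: "'d \<Rightarrow> real \<Rightarrow> real"
    and Q :: "real ^ 'd ^ 'd"
    and \<nu> :: "(real ^ 'd) measure"
    and \<mu> :: "real measure"
    and g l :: nat
    and \<eta> \<alpha> :: "nat \<Rightarrow> real"
  assumes "filtered_prob_space M Filt"
    and "levy_martingale M Filt Z"
    and "independent_coordinates M Z"
    and "wiener_cov_levy_measure M Z Q \<nu>"
    and "(\<forall>i. (AE \<omega> in M. \<forall>t>0. Z t \<omega> $ i - left_limit (\<lambda>s. Z s \<omega> $ i) t \<ge> 0) \<and>
              (AE \<omega> in M. \<forall>t>0. infinite_variation (\<lambda>s. Z s \<omega> $ i) t)) \<or>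
         ((\<forall>i. AE \<omega> in M. \<forall>t>0. Z t \<omega> $ i - left_limit (\<lambda>s. Z s \<omega> $ i) t \<ge> 0) \<and> G 0 = 0)"
    and "\<forall>i. has_laplace_exponent M (\<lambda>t \<omega>. Z t \<omega> $ i) (J i)"
    and "\<forall>i. varies_regularly_at_zero (J i)"
    and "\<forall>i. (\<forall>x\<ge>0. G x $ i \<ge> 0) \<and> continuous_on {0..} (\<lambda>x. G x $ i)"
    and "generates_affine_model M Filt Z Fd G"
    and "1 \<le> g" and "g \<le> CARD('d)"
    and "\<forall>k\<in>{1..g}. \<eta> k > 0"
    and "\<alpha> 1 \<le> 2" and "\<alpha> g > 1"
    and "\<forall>j\<in>{1..g}. \<forall>k\<in>{1..g}. j < k \<longrightarrow> \<alpha> j > \<alpha> k"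
    and "\<forall>x\<ge>0. has_laplace_exponent M (\<lambda>t \<omega>. G x \<bullet> Z t \<omega>)
                  (\<lambda>\<beta>. x * (\<Sum>k=1..g. \<eta> k * \<beta> powr \<alpha> k))"
    and "affine_jump_measure Q \<nu> G \<mu>"
    and "l = (if \<alpha> 1 = 2 then 2 else 1)"
  shows "(\<forall>k\<in>{l..g}. \<eta> k > 0 \<and> 1 < \<alpha> k \<and> \<alpha> k < 2)
    \<and> (\<forall>j\<in>{l..g}. \<forall>k\<in>{l..g}. j < k \<longrightarrow> \<alpha> j > \<alpha> k)
    \<and> (\<forall>\<beta>\<ge>0. J_measure \<mu> \<beta> = (\<Sum>k=l..g. \<eta> k * \<beta> powr \<alpha> k))
    \<and> (\<forall>A\<in>sets \<mu>. emeasure \<mu> A =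
          (\<Sum>k=l..g. emeasure (stable_measure (\<eta> k / stable_const (\<alpha> k)) (\<alpha> k)) A))
    \<and> (l = 2 \<and> g = 1 \<longrightarrow> (\<forall>\<beta>\<ge>0. J_measure \<mu> \<beta> = 0) \<and> emeasure \<mu> (space \<mu>) = 0)"
proof -
  have M: "prob_space M" using assms(1) by (simp add: filtered_prob_space_def)
  note W = assms(4) and \<eta> = assms(12) and \<alpha>1 = assms(13) and \<alpha>g = assms(14) and dec = assms(15)
    and lap = assms(16) and aff = assms(17) and l = assms(18)
  have g: "1 \<le> g" by fact
  have lk: "k \<in> {1..g}" if "k \<in> {l..g}" for k using that l by (auto split: if_splits)
  \<comment> \<open>If \<open>\<alpha> 1 = 2\<close>, the range starts at 2 and strict decrease puts
    every remaining index below 2; otherwise already \<open>\<alpha> 1 < 2\<close>.\<close>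
  have \<alpha>: "1 < \<alpha> k \<and> \<alpha> k < 2" if k: "k \<in> {l..g}" for k
  proof
    show "1 < \<alpha> k"
      using dec[rule_format, of k g] lk[OF k] \<alpha>g by (cases "k = g") auto
    show "\<alpha> k < 2"
      using dec[rule_format, of 1 k] lk[OF k] g \<alpha>1 l k by (cases "k = 1") (auto split: if_splits)
  qed
  have I: "0 \<le> \<eta> k \<and> 1 < \<alpha> k \<and> \<alpha> k < 2" if "k \<in> {l..g}" for k
    using \<alpha>[OF that] \<eta> lk[OF that] by (auto intro: less_imp_le)
  let ?\<rho> = "stable_mixture {l..g} \<eta> \<alpha>"
  have sets\<mu>: "sets \<mu> = sets (restrict_space borel {0<..})"
    and jump: "\<And>x A. 0 \<le> x \<Longrightarrow> A \<in> sets borel \<Longrightarrow> A \<subseteq> {0<..} \<Longrightarrow>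
        emeasure (image_levy_measure \<nu> (G x)) A =
          emeasure (image_levy_measure \<nu> (G 0)) A + ennreal x * emeasure \<mu> A"
    using aff unfolding affine_jump_measure_def by blast+
  have int\<rho>: "(LINT v|?\<rho>. exp (- \<beta> * v) - 1 + \<beta> * v) = (\<Sum>k=l..g. \<eta> k * \<beta> powr \<alpha> k)" if "0 \<le> \<beta>" for \<beta>
    by (rule integral_compensated_stable_mixture[OF _ that]) (rule I)
  have min\<rho>: "integrable ?\<rho> (\<lambda>v. min \<bar>v\<bar> (v\<^sup>2))"
    by (rule integrable_min_stable_mixture) (rule I)
  \<comment> \<open>A term with index 2 is Gaussian: \<open>\<eta> 1 * \<beta>\<^sup>2\<close>
    corresponds to the coefficient \<open>2 * \<eta> 1\<close> in front of
    \<open>\<beta>\<^sup>2 / 2\<close>. The leading factor 1 is the value \<open>x = 1\<close> in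
    the assumed exponent.\<close>
  have split: "1 * (\<Sum>k=1..g. \<eta> k * \<beta> powr \<alpha> k)
      = (if \<alpha> 1 = 2 then 2 * \<eta> 1 else 0) * \<beta>\<^sup>2 / 2 + (LINT v|?\<rho>. exp (- \<beta> * v) - 1 + \<beta> * v)"
    if "0 \<le> \<beta>" for \<beta>
    unfolding int\<rho>[OF that]
    using sum.atLeast_Suc_atMost[OF g, of "\<lambda>k. \<eta> k * \<beta> powr \<alpha> k"] that
    by (cases "\<alpha> 1 = 2") (simp_all add: l numeral_2_eq_2[symmetric])
  have \<mu>: "emeasure \<mu> A = emeasure ?\<rho> A" if A: "A \<in> sets borel" "A \<subseteq> {0<..}" for A
  proof -
    have A0: "0 \<notin> A" using A(2) by auto
    have "emeasure (image_levy_measure \<nu> (G 1)) A = emeasure ?\<rho> A"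
      by (rule image_levy_measure_unique[OF M W lap[rule_format, of 1] sets_stable_mixture
            min\<rho> AE_stable_mixture_pos split A(1) A0]) auto
    \<comment> \<open>At \<open>x = 0\<close> the exponent is zero, which the null measure
      represents together with \<open>q = 0\<close>; hence the constant term of the affine
      decomposition disappears.\<close>
    moreover have "emeasure (image_levy_measure \<nu> (G 0)) A = emeasure (null_measure borel) A"
    proof (rule image_levy_measure_unique[OF M W lap[rule_format, of 0], where q = 0])
      show "AE v in null_measure borel. 0 < (v::real)"
        by (rule AE_I[where N = UNIV]) auto
    qed (use A A0 in auto)
    ultimately show ?thesis using jump[of 1 A] A by simp
  qed
  \<comment> \<open>Restriction reconciles the two carriers: \<open>\<mu>\<close> is a measure on
    the positive half-line, the mixture one on the whole line.\<close>
  have \<mu>_eq: "\<mu> = restrict_space ?\<rho> {0<..}"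
  proof (rule measure_eqI)
    show "sets \<mu> = sets (restrict_space ?\<rho> {0<..})"
      unfolding sets\<mu> by (rule sets_restrict_space_cong) simp
    show "emeasure \<mu> A = emeasure (restrict_space ?\<rho> {0<..}) A" if "A \<in> sets \<mu>" for A
    proof -
      have A: "A \<in> sets borel" "A \<subseteq> {0<..}"
        using that unfolding sets\<mu> by (auto simp: sets_restrict_space_iff)
      then show ?thesis by (simp add: \<mu> emeasure_restrict_space)
    qed
  qed
  have J: "J_measure \<mu> \<beta> = (\<Sum>k=l..g. \<eta> k * \<beta> powr \<alpha> k)" if "0 \<le> \<beta>" for \<beta>
  proof -
    have "J_measure \<mu> \<beta> = (LINT v|?\<rho>. indicator {0<..} v *\<^sub>R (exp (- \<beta> * v) - 1 + \<beta> * v))"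
      unfolding J_measure_def \<mu>_eq by (rule integral_restrict_space) simp
    also have "\<dots> = (LINT v|?\<rho>. exp (- \<beta> * v) - 1 + \<beta> * v)"
    proof (rule integral_cong_AE)
      show "AE v in ?\<rho>. indicator {0<..} v *\<^sub>R (exp (- \<beta> * v) - 1 + \<beta> * v) = exp (- \<beta> * v) - 1 + \<beta> * v"
        using AE_stable_mixture_pos by (rule eventually_mono) simp
    qed (auto simp: measurable_cong_sets[OF sets_stable_mixture refl])
    finally show ?thesis using int\<rho>[OF that] by simp
  qed
  have \<mu>_sum: "emeasure \<mu> A = (\<Sum>k=l..g. emeasure (stable_measure (\<eta> k / stable_const (\<alpha> k)) (\<alpha> k)) A)"
    if "A \<in> sets \<mu>" for A
  proof -
    have "A \<in> sets borel" "A \<subseteq> {0<..}"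
      using that unfolding sets\<mu> by (auto simp: sets_restrict_space_iff)
    then show ?thesis by (simp add: \<mu> emeasure_stable_mixture)
  qed
  \<comment> \<open>For \<open>l = 2\<close> and \<open>g = 1\<close> the index range is empty, so
    both sums vanish; the total mass is the formula for \<open>\<mu>\<close> on its whole
    space.\<close>
  show ?thesis
    using \<alpha> \<eta> lk dec J \<mu>_sum[OF sets.top] \<mu>_sum by auto
qed

end
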